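(* Let $\mathcal{E}=\{\eta_i,\rho_i\}_{i=0}^{n-1}$ be a bipartite quantum state ensemble on $\mathcal{H}=\mathbb{C}^{d_{\rm A}}\otimes\mathbb{C}^{d_{\rm B}}$ with $q_{\rm G}(\mathcal{E})<\frac{2}{n}$. Then $$\lim_{L\to\infty}p_{\rm L}(\mathcal{E}^{(L)})=\frac1n.$$
   Context: Let $\mathcal{H}=\mathbb{C}^{d_{\rm A}}\otimes\mathbb{C}^{d_{\rm B}}$ be a finite-dimensional bipartite Hilbert space, the first factor held by Alice and the second by Bob. A state is a density operator $\rho\succeq 0$, $\operatorname{Tr}\rho=1$. A bipartite quantum state ensemble $\mathcal{E}=\{\eta_i,\rho_i\}_{i=0}^{n-1}$ consists of states $\rho_i$ and prior probabilities $\eta_i\in[0,1]$ with $\sum_i\eta_i=1$. A measurement $\mathcal{M}=\{M_i\}_{i=0}^{n-1}$ is a family of positive-semidefinite operators with $\sum_i M_i=I$. It is a LOCC measurement if it can be realized by local operations and classical communication between Alice and Bob, i.e. by rounds of local quantum instruments of the parties, each chosen depending on previously communicated classical outcomes, with the final index a function of the classical record. The superscript $\mathrm{PT}$ denotes partial transposition: transposition, in a fixed orthonormal product basis, of one fixed party's subsystem. Define $$q_{\rm G}(\mathcal{E})=\max_{\mathcal{M}}\sum_{i=0}^{n-1}\eta_i\operatorname{Tr}(\rho_i^{\mathrm{PT}}M_i),\qquad p_{\rm L}(\mathcal{E})=\max_{\mathrm{LOCC}\ \mathcal{M}}\sum_{i=0}^{n-1}\eta_i\operatorname{Tr}(\rho_iM_i),$$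 the first over all measurements and the second over LOCC measurements (read as a supremum if not attained). For $\mathcal{E}=\{\eta_i,\rho_i\}_{i=0}^{n-1}$, a positive integer $L$, and $\vec c=(c_1,\dots,c_L)\in\mathbb{Z}_n^L$ with $\mathbb{Z}_n=\{0,\dots,n-1\}$, put $\eta_{\vec c}=\prod_{l=1}^L\eta_{c_l}$, $\rho_{\vec c}=\bigotimes_{l=1}^L\rho_{c_l}$, and $\omega_n(\vec c)=\sum_{l=1}^L c_l \pmod n\in\mathbb{Z}_n$. Define $$\eta_i^{(L)}=\sum_{\vec c\in\mathbb{Z}_n^L,\ \omega_n(\vec c)=i}\eta_{\vec c},\qquad \rho_i^{(L)}=\frac{1}{\eta_i^{(L)}}\sum_{\vec c\in\mathbb{Z}_n^L,\ \omega_n(\vec c)=i}\eta_{\vec c}\,\rho_{\vec c},\qquad \mathcal{E}^{(L)}=\{\eta_i^{(L)},\rho_i^{(L)}\}_{i=0}^{n-1}$$ (if $\eta_i^{(L)}=0$, $\rho_i^{(L)}$ is an arbitrary state). $\mathcal{E}^{(L)}$ is regarded as a bipartite ensemble on $\mathcal{H}^{\otimes L}\cong(\mathbb{C}^{d_{\rm A}})^{\otimes L}\otimes(\mathbb{C}^{d_{\rm B}})^{\otimes L}$, Alice holding all $L$ copies of $\mathbb{C}^{d_{\rm A}}$ and Bob all $L$ copies of $\mathbb{C}^{d_{\rm B}}$; partial transposition and LOCC for $\mathcal{E}^{(L)}$ are with respect to this bipartition. *)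

theory Defs
  imports Complex_Main "Jordan_Normal_Form.Matrix" "Jordan_Normal_Form.Conjugate"
begin

(* Operators on C^dA (x) C^dB are complex matrices of dimension dA * dB, the
   product basis vector e_a (x) e_b having index a * dB + b. *)

definition mat_trace :: "complex mat \<Rightarrow> complex" where
  "mat_trace A = (\<Sum>i<dim_row A. A $$ (i, i))"

(* In the order on complex used here, 0 \<le> z says that z is real and nonnegative;
   hence psd matrices are Hermitian. *)
definition psd :: "nat \<Rightarrow> complex mat \<Rightarrow> bool" where
  "psd d A \<longleftrightarrow> A \<in> carrier_mat d d \<and> (\<forall>v \<in> carrier_vec d. 0 \<le> (A *\<^sub>v v) \<bullet>c v)"

definition state :: "nat \<Rightarrow> complex mat \<Rightarrow> bool" where
  "state d \<rho> \<longleftrightarrow> psd d \<rho> \<and> mat_trace \<rho> = 1"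

definition measurement :: "nat \<Rightarrow> nat \<Rightarrow> (nat \<Rightarrow> complex mat) \<Rightarrow> bool" where
  "measurement n d M \<longleftrightarrow>
     (\<forall>i<n. psd d (M i)) \<and> mat d d (\<lambda>rs. \<Sum>i<n. M i $$ rs) = 1\<^sub>m d"

definition ensemble :: "nat \<Rightarrow> nat \<Rightarrow> (nat \<Rightarrow> real) \<Rightarrow> (nat \<Rightarrow> complex mat) \<Rightarrow> bool" where
  "ensemble n d \<eta> \<rho> \<longleftrightarrow>
     (\<forall>i<n. 0 \<le> \<eta> i \<and> \<eta> i \<le> 1 \<and> state d (\<rho> i)) \<and> (\<Sum>i<n. \<eta> i) = 1"

datatype party = Alice | Bob

fun partial_transpose :: "party \<Rightarrow> nat \<Rightarrow> nat \<Rightarrow> complex mat \<Rightarrow> complex mat" where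
  "partial_transpose Alice dA dB X = mat (dA * dB) (dA * dB)
     (\<lambda>(r, s). X $$ ((s div dB) * dB + r mod dB, (r div dB) * dB + s mod dB))"
| "partial_transpose Bob dA dB X = mat (dA * dB) (dA * dB)
     (\<lambda>(r, s). X $$ ((r div dB) * dB + s mod dB, (s div dB) * dB + r mod dB))"

(* For a linear map Phi from d x d to d' x d' matrices, map_left d d' k Phi is
   Phi (x) id_k and map_right k d d' Phi is id_k (x) Phi: Phi is applied to the
   d x d submatrices obtained by fixing the row and column index of the other factor. *)

definition map_left ::
  "nat \<Rightarrow> nat \<Rightarrow> nat \<Rightarrow> (complex mat \<Rightarrow> complex mat) \<Rightarrow> complex mat \<Rightarrow> complex mat" where
  "map_left d d' k \<Phi> X = mat (d' * k) (d' * k)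
     (\<lambda>(r, s). \<Phi> (mat d d (\<lambda>(a, a'). X $$ (a * k + r mod k, a' * k + s mod k)))
               $$ (r div k, s div k))"

definition map_right ::
  "nat \<Rightarrow> nat \<Rightarrow> nat \<Rightarrow> (complex mat \<Rightarrow> complex mat) \<Rightarrow> complex mat \<Rightarrow> complex mat" where
  "map_right k d d' \<Phi> X = mat (k * d') (k * d')
     (\<lambda>(r, s). \<Phi> (mat d d (\<lambda>(b, b'). X $$ ((r div d') * d + b, (s div d') * d + b')))
               $$ (r mod d', s mod d'))"

definition completely_positive :: "nat \<Rightarrow> nat \<Rightarrow> (complex mat \<Rightarrow> complex mat) \<Rightarrow> bool" where
  "completely_positive d d' \<Phi> \<longleftrightarrow>
     (\<forall>X \<in> carrier_mat d d. \<Phi> X \<in> carrier_mat d' d') \<and>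
     (\<forall>X \<in> carrier_mat d d. \<forall>Y \<in> carrier_mat d d. \<Phi> (X + Y) = \<Phi> X + \<Phi> Y) \<and>
     (\<forall>c. \<forall>X \<in> carrier_mat d d. \<Phi> (c \<cdot>\<^sub>m X) = c \<cdot>\<^sub>m \<Phi> X) \<and>
     (\<forall>k X. psd (d * k) X \<longrightarrow> psd (d' * k) (map_left d d' k \<Phi> X))"

(* A quantum instrument with outcomes j < m; the output dimension e j may depend on
   the outcome. *)
definition instrument ::
  "nat \<Rightarrow> nat \<Rightarrow> (nat \<Rightarrow> nat) \<Rightarrow> (nat \<Rightarrow> complex mat \<Rightarrow> complex mat) \<Rightarrow> bool" where
  "instrument m d e \<Phi> \<longleftrightarrow>
     (\<forall>j<m. completely_positive d (e j) (\<Phi> j)) \<and>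
     (\<forall>X \<in> carrier_mat d d. (\<Sum>j<m. mat_trace (\<Phi> j X)) = mat_trace X)"

(* locc_protocol n dA dB P: some LOCC protocol with final indices below n, acting on
   C^dA (x) C^dB, yields index i on input X with probability P i X.  Such a protocol
   either stops and announces an index, or lets one party apply an instrument and
   continues with a protocol that depends on the communicated outcome j.  Along each
   branch the index announced is thus a function of the classical record. *)
inductive locc_protocol ::
  "nat \<Rightarrow> nat \<Rightarrow> nat \<Rightarrow> (nat \<Rightarrow> complex mat \<Rightarrow> complex) \<Rightarrow> bool" for n where
  announce: "k < n \<Longrightarrow>
    locc_protocol n dA dB (\<lambda>i X. if i = k then mat_trace X else 0)"
| alice: "instrument m dA e \<Phi> \<Longrightarrow> (\<And>j. j < m \<Longrightarrow> locc_protocol n (e j) dB (P j)) \<Longrightarrow>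
    locc_protocol n dA dB (\<lambda>i X. \<Sum>j<m. P j i (map_left dA (e j) dB (\<Phi> j) X))"
| bob: "instrument m dB e \<Phi> \<Longrightarrow> (\<And>j. j < m \<Longrightarrow> locc_protocol n dA (e j) (P j)) \<Longrightarrow>
    locc_protocol n dA dB (\<lambda>i X. \<Sum>j<m. P j i (map_right dA dB (e j) (\<Phi> j) X))"

definition locc_measurement :: "nat \<Rightarrow> nat \<Rightarrow> nat \<Rightarrow> (nat \<Rightarrow> complex mat) \<Rightarrow> bool" where
  "locc_measurement n dA dB M \<longleftrightarrow> measurement n (dA * dB) M \<and>
     (\<exists>P. locc_protocol n dA dB P \<and>
        (\<forall>\<rho> i. state (dA * dB) \<rho> \<longrightarrow> i < n \<longrightarrow> P i \<rho> = mat_trace (\<rho> * M i)))"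

(* The traces below are real: products of Hermitian matrices. *)

definition q_G ::
  "party \<Rightarrow> nat \<Rightarrow> nat \<Rightarrow> nat \<Rightarrow> (nat \<Rightarrow> real) \<Rightarrow> (nat \<Rightarrow> complex mat) \<Rightarrow> real" where
  "q_G p n dA dB \<eta> \<rho> =
     Sup {\<Sum>i<n. \<eta> i * Re (mat_trace (partial_transpose p dA dB (\<rho> i) * M i)) | M.
           measurement n (dA * dB) M}"

definition p_L ::
  "nat \<Rightarrow> nat \<Rightarrow> nat \<Rightarrow> (nat \<Rightarrow> real) \<Rightarrow> (nat \<Rightarrow> complex mat) \<Rightarrow> real" where
  "p_L n dA dB \<eta> \<rho> =
     Sup {\<Sum>i<n. \<eta> i * Re (mat_trace (\<rho> i * M i)) | M. locc_measurement n dA dB M}"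

(* Tensor product of an operator X on C^a1 (x) C^b1 and Y on C^a2 (x) C^b2, regrouped as
   an operator on (C^a1 (x) C^a2) (x) (C^b1 (x) C^b2). *)
definition bip_index :: "nat \<Rightarrow> nat \<Rightarrow> nat \<Rightarrow> nat \<Rightarrow> nat \<times> nat" where
  "bip_index b1 a2 b2 r =
     (let a = r div (b1 * b2); b = r mod (b1 * b2)
      in ((a div a2) * b1 + b div b2, (a mod a2) * b2 + b mod b2))"

definition bip_tensor ::
  "nat \<Rightarrow> nat \<Rightarrow> nat \<Rightarrow> nat \<Rightarrow> complex mat \<Rightarrow> complex mat \<Rightarrow> complex mat" where
  "bip_tensor a1 b1 a2 b2 X Y = mat (a1 * a2 * (b1 * b2)) (a1 * a2 * (b1 * b2))
     (\<lambda>(r, s). X $$ (fst (bip_index b1 a2 b2 r), fst (bip_index b1 a2 b2 s)) *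
               Y $$ (snd (bip_index b1 a2 b2 r), snd (bip_index b1 a2 b2 s)))"

fun bip_tensor_list :: "nat \<Rightarrow> nat \<Rightarrow> complex mat list \<Rightarrow> complex mat" where
  "bip_tensor_list dA dB [] = 1\<^sub>m 1"
| "bip_tensor_list dA dB (X # Xs) =
     bip_tensor dA dB (dA ^ length Xs) (dB ^ length Xs) X (bip_tensor_list dA dB Xs)"

definition words :: "nat \<Rightarrow> nat \<Rightarrow> nat \<Rightarrow> nat list set" where
  "words n L i = {c. length c = L \<and> set c \<subseteq> {..<n} \<and> sum_list c mod n = i}"

definition power_prior :: "nat \<Rightarrow> (nat \<Rightarrow> real) \<Rightarrow> nat \<Rightarrow> nat \<Rightarrow> real" where
  "power_prior n \<eta> L i = (\<Sum>c\<in>words n L i. prod_list (map \<eta> c))"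

definition power_state ::
  "nat \<Rightarrow> nat \<Rightarrow> nat \<Rightarrow> (nat \<Rightarrow> real) \<Rightarrow> (nat \<Rightarrow> complex mat) \<Rightarrow> nat \<Rightarrow> nat \<Rightarrow> complex mat" where
  "power_state n dA dB \<eta> \<rho> L i = mat (dA ^ L * dB ^ L) (dA ^ L * dB ^ L)
     (\<lambda>rs. (1 / complex_of_real (power_prior n \<eta> L i)) *
        (\<Sum>c\<in>words n L i. complex_of_real (prod_list (map \<eta> c)) *
           bip_tensor_list dA dB (map \<rho> c) $$ rs))"

(* \<sigma> is an admissible choice of the states of the L-fold ensemble: they are determined
   where the prior is nonzero and arbitrary states elsewhere. *)
definition power_states ::
  "nat \<Rightarrow> nat \<Rightarrow> nat \<Rightarrow> (nat \<Rightarrow> real) \<Rightarrow> (nat \<Rightarrow> complex mat) \<Rightarrow> nat \<Rightarrow> (nat \<Rightarrow> complex mat) \<Rightarrow> bool"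
where
  "power_states n dA dB \<eta> \<rho> L \<sigma> \<longleftrightarrow>
     (\<forall>i<n. if power_prior n \<eta> L i = 0 then state (dA ^ L * dB ^ L) (\<sigma> i)
            else \<sigma> i = power_state n dA dB \<eta> \<rho> L i)"

end

theory Submission
  imports Defs
begin

text \<open>Write \<open>A\<^sub>i = \<eta>\<^sub>i \<rho>\<^sub>i\<^sup>P\<^sup>T\<close> and let \<open>F\<^sub>k = \<Sum>\<^sub>i \<omega>\<^sup>k\<^sup>i A\<^sub>i\<close> be its discrete Fourier transform over
  \<open>\<int>\<^sub>n\<close>. For \<open>k \<noteq> 0\<close> every contraction \<open>V\<close> gives a measurement showing
  \<open>1 + Re Tr (F\<^sub>k V) \<le> n q\<^sub>G\<close>, so \<open>q\<^sub>G < 2/n\<close> bounds the trace norm of \<open>F\<^sub>k\<close> by some \<open>s < 1\<close>.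
  The Fourier transform of the \<open>L\<close>-fold ensemble consists of the tensor powers of the \<open>F\<^sub>k\<close>, and
  the trace norm is submultiplicative; the component \<open>k = 0\<close> contributes exactly \<open>1/n\<close>, so every
  measurement pairs with the partially transposed \<open>L\<close>-fold ensemble to \<open>1/n\<close> up to \<open>n s\<^sup>L\<close>.
  Finally, LOCC measurements stay positive under partial transposition, so all their success
  probabilities on the \<open>L\<close>-fold ensemble lie in this range.\<close>

section \<open>Bounds on forms and traces\<close>

text \<open>Uniform guessing already yields 1/n, so n q_G - 1 measures the advantage over it; this
  is the bound obtained for the trace norm of every nontrivial Fourier component, and it is below 1
  exactly when q_G < 2/n. The transform is needed because the words with a given residue do not form
  a product set, while a character of the sum of the letters splits into a product over the letters.
  The components are in general not Hermitian, so their trace norm is not a difference of traces of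
  positive parts. It is encoded by duality instead: a bound \<open>s\<close> means that pairing with
  any operator of norm at most \<open>c\<close> gives modulus at most \<open>s * c\<close>. This is
  precisely how measurement effects enter, and it makes submultiplicativity elementary. Operators
  are functions on arbitrary index sets, so that tensor products live on \<open>I \<times> J\<close>
  and the index arithmetic of matrices is confined to a few bijections.\<close>

definition sesq :: "'a set \<Rightarrow> ('a \<Rightarrow> 'a \<Rightarrow> complex) \<Rightarrow> ('a \<Rightarrow> complex) \<Rightarrow> ('a \<Rightarrow> complex) \<Rightarrow> complex" where
  "sesq I A u v = (\<Sum>i\<in>I. \<Sum>j\<in>I. cnj (u i) * A i j * v j)"

definition nrm :: "'a set \<Rightarrow> ('a \<Rightarrow> complex) \<Rightarrow> real" where
  "nrm I v = sqrt (\<Sum>i\<in>I. (cmod (v i))\<^sup>2)"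

text \<open>Operator norm at most \<open>c\<close>, in bilinear form. The clause
  \<open>0 \<le> c\<close> matters when all norms vanish, as on an empty index set, where the
  inequality does not constrain \<open>c\<close>.\<close>

definition op_bound :: "'a set \<Rightarrow> ('a \<Rightarrow> 'a \<Rightarrow> complex) \<Rightarrow> real \<Rightarrow> bool" where
  "op_bound I A c \<longleftrightarrow> 0 \<le> c \<and> (\<forall>u v. cmod (sesq I A u v) \<le> c * (nrm I u * nrm I v))"

definition tr_prod :: "'a set \<Rightarrow> ('a \<Rightarrow> 'a \<Rightarrow> complex) \<Rightarrow> ('a \<Rightarrow> 'a \<Rightarrow> complex) \<Rightarrow> complex" where
  "tr_prod I X U = (\<Sum>i\<in>I. \<Sum>j\<in>I. X i j * U j i)"

text \<open>Trace norm at most \<open>s\<close>, as the dual of the operator norm. Keeping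
  \<open>c\<close> free makes rescaling of \<open>U\<close> unnecessary for the users of the
  bound.\<close>

definition trace_bound :: "'a set \<Rightarrow> ('a \<Rightarrow> 'a \<Rightarrow> complex) \<Rightarrow> real \<Rightarrow> bool" where
  "trace_bound I X s \<longleftrightarrow> (\<forall>U c. op_bound I U c \<longrightarrow> cmod (tr_prod I X U) \<le> s * c)"

definition pos_form :: "'a set \<Rightarrow> ('a \<Rightarrow> 'a \<Rightarrow> complex) \<Rightarrow> bool" where
  "pos_form I A \<longleftrightarrow> (\<forall>v. 0 \<le> sesq I A v v)"

lemma nrm_nonneg [simp]: "0 \<le> nrm I v"
  by (simp add: nrm_def sum_nonneg)

lemma nrm_sq: "(nrm I v)\<^sup>2 = (\<Sum>i\<in>I. (cmod (v i))\<^sup>2)"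
  by (simp add: nrm_def sum_nonneg)

lemma nrm_eq_0: "finite I \<Longrightarrow> nrm I v = 0 \<Longrightarrow> i \<in> I \<Longrightarrow> v i = 0"
  by (simp add: nrm_def sum_nonneg_eq_0_iff)

lemma sesq_add_left: "sesq I A (\<lambda>i. u i + w i) v = sesq I A u v + sesq I A w v"
  by (simp add: sesq_def algebra_simps sum.distrib)

lemma sesq_add_right: "sesq I A u (\<lambda>i. v i + w i) = sesq I A u v + sesq I A u w"
  by (simp add: sesq_def algebra_simps sum.distrib)

lemma sesq_scale_left: "sesq I A (\<lambda>i. c * u i) v = cnj c * sesq I A u v"
  by (simp add: sesq_def algebra_simps sum_distrib_left)

lemma sesq_scale_right: "sesq I A u (\<lambda>i. c * v i) = c * sesq I A u v"
  by (simp add: sesq_def algebra_simps sum_distrib_left)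

lemma sesq_scale_op: "sesq I (\<lambda>i j. c * A i j) u v = c * sesq I A u v"
  by (simp add: sesq_def algebra_simps sum_distrib_left)

lemma sesq_add_op: "sesq I (\<lambda>i j. A i j + B i j) u v = sesq I A u v + sesq I B u v"
  by (simp add: sesq_def algebra_simps sum.distrib)

lemma sesq_sum_op: "sesq I (\<lambda>i j. \<Sum>k\<in>K. A k i j) u v = (\<Sum>k\<in>K. sesq I (A k) u v)"
  by (simp add: sesq_def sum_distrib_left sum_distrib_right sum.swap[of _ _ K])

lemma sesq_cong: "(\<And>i j. i \<in> I \<Longrightarrow> j \<in> I \<Longrightarrow> A i j = B i j) \<Longrightarrow> sesq I A u v = sesq I B u v"
  by (auto simp: sesq_def intro!: sum.cong)

lemma sesq_adjoint: "sesq I (\<lambda>i j. cnj (A j i)) u v = cnj (sesq I A v u)"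
  unfolding sesq_def by (subst sum.swap) (simp add: mult_ac)

lemma sesq_id:
  assumes "finite I"
  shows "sesq I (\<lambda>i j. if i = j then 1 else 0) v v = complex_of_real ((nrm I v)\<^sup>2)"
proof -
  have "sesq I (\<lambda>i j. if i = j then 1 else 0) v v
      = (\<Sum>i\<in>I. \<Sum>j\<in>I. if i = j then cnj (v i) * v j else 0)"
    unfolding sesq_def by (intro sum.cong refl) simp
  also have "\<dots> = (\<Sum>i\<in>I. cnj (v i) * v i)"
    using assms by simp
  also have "\<dots> = (\<Sum>i\<in>I. complex_of_real ((cmod (v i))\<^sup>2))"
    by (intro sum.cong refl) (metis complex_norm_square mult.commute)
  finally show ?thesis by (simp add: nrm_sq)
qed

lemma sesq_unit:
  assumes "finite I" "i \<in> I" "j \<in> I"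
  shows "sesq I A (\<lambda>k. if k = i then 1 else 0) (\<lambda>k. if k = j then 1 else 0) = A i j"
proof -
  have "sesq I A (\<lambda>k. if k = i then 1 else 0) (\<lambda>k. if k = j then 1 else 0)
      = (\<Sum>k\<in>I. \<Sum>l\<in>I. if l = j then (if k = i then A k l else 0) else 0)"
    unfolding sesq_def by (intro sum.cong refl) auto
  then show ?thesis using assms by simp
qed

lemma nrm_unit: "finite I \<Longrightarrow> i \<in> I \<Longrightarrow> nrm I (\<lambda>k. if k = i then 1 else 0) = 1"
  by (simp add: nrm_def if_distrib[of "\<lambda>x. (cmod x)\<^sup>2"] cong: if_cong)

lemma cmod_le_nrm: "finite I \<Longrightarrow> i \<in> I \<Longrightarrow> cmod (v i) \<le> nrm I v"
  unfolding nrm_def by (rule real_le_rsqrt) (rule member_le_sum, auto)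

lemma op_bound_entry:
  assumes "finite I" "op_bound I U c" "i \<in> I" "j \<in> I"
  shows "cmod (U i j) \<le> c"
proof -
  have "cmod (sesq I U (\<lambda>k. if k = i then 1 else 0) (\<lambda>k. if k = j then 1 else 0))
      \<le> c * (nrm I (\<lambda>k. if k = i then 1 else 0) * nrm I (\<lambda>k. if k = j then 1 else 0))"
    using assms(2) unfolding op_bound_def by blast
  then show ?thesis using assms by (simp add: sesq_unit nrm_unit)
qed

text \<open>Crude, but any finite bound suffices: it supplies the multiple of the identity that
  makes a Hermitian matrix positive.\<close>

lemma op_bound_sum_entries:
  assumes fin: "finite I"
  shows "op_bound I A (\<Sum>i\<in>I. \<Sum>j\<in>I. cmod (A i j))"
  unfolding op_bound_def
proof (intro conjI allI)
  fix u v
  have "cmod (sesq I A u v) \<le> (\<Sum>i\<in>I. \<Sum>j\<in>I. cmod (cnj (u i) * A i j * v j))"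
    unfolding sesq_def by (rule order_trans[OF norm_sum sum_mono[OF norm_sum]])
  also have "\<dots> \<le> (\<Sum>i\<in>I. \<Sum>j\<in>I. cmod (A i j) * (nrm I u * nrm I v))"
  proof (intro sum_mono)
    fix i j assume "i \<in> I" "j \<in> I"
    then have "cmod (u i) * cmod (v j) \<le> nrm I u * nrm I v"
      using fin by (intro mult_mono cmod_le_nrm) auto
    then show "cmod (cnj (u i) * A i j * v j) \<le> cmod (A i j) * (nrm I u * nrm I v)"
      using mult_left_mono[of "cmod (u i) * cmod (v j)" "nrm I u * nrm I v" "cmod (A i j)"] by (simp add: norm_mult mult_ac)
  qed
  finally show "cmod (sesq I A u v) \<le> (\<Sum>i\<in>I. \<Sum>j\<in>I. cmod (A i j)) * (nrm I u * nrm I v)"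
    by (simp add: sum_distrib_right)
qed (simp add: sum_nonneg)

text \<open>Again only finiteness matters: it bounds the set whose supremum is
  \<open>q_G\<close>.\<close>

lemma trace_bound_sum_entries:
  assumes fin: "finite I"
  shows "trace_bound I A (\<Sum>i\<in>I. \<Sum>j\<in>I. cmod (A i j))"
  unfolding trace_bound_def
proof (intro allI impI)
  fix U c assume U: "op_bound I U c"
  have "cmod (tr_prod I A U) \<le> (\<Sum>i\<in>I. \<Sum>j\<in>I. cmod (A i j * U j i))"
    unfolding tr_prod_def by (rule order_trans[OF norm_sum sum_mono[OF norm_sum]])
  also have "\<dots> \<le> (\<Sum>i\<in>I. \<Sum>j\<in>I. cmod (A i j) * c)"
    using op_bound_entry[OF fin U] by (intro sum_mono) (simp add: norm_mult mult_left_mono)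
  finally show "cmod (tr_prod I A U) \<le> (\<Sum>i\<in>I. \<Sum>j\<in>I. cmod (A i j)) * c"
    by (simp add: sum_distrib_right)
qed

lemma nrm_scale: "nrm I (\<lambda>i. c * u i) = cmod c * nrm I u"
  by (simp add: nrm_def norm_mult power_mult_distrib real_sqrt_mult flip: sum_distrib_left)

lemma nrm_times: "nrm (I \<times> J) (\<lambda>(i, j). u i * v j) = nrm I u * nrm J v"
proof -
  have "(\<Sum>p\<in>I \<times> J. (cmod (case p of (i, j) \<Rightarrow> u i * v j))\<^sup>2)
      = (\<Sum>i\<in>I. (cmod (u i))\<^sup>2) * (\<Sum>j\<in>J. (cmod (v j))\<^sup>2)"
    unfolding sum.cartesian_product' sum_product by (simp add: norm_mult power_mult_distrib)
  then show ?thesis by (simp add: nrm_def real_sqrt_mult)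
qed

text \<open>Polarization: the form is real at \<open>u + v\<close>, which relates the imaginary
  parts, and at \<open>u + \<i> * v\<close>, which relates the real parts.\<close>

lemma pos_form_hermitian:
  assumes "pos_form I A"
  shows "sesq I A v u = cnj (sesq I A u v)"
proof -
  have im0: "Im (sesq I A w w) = 0" for w
    using assms by (simp add: pos_form_def less_eq_complex_def)
  have "Im (sesq I A (\<lambda>i. u i + v i) (\<lambda>i. u i + v i)) = 0" by (rule im0)
  then have 1: "Im (sesq I A u v) = - Im (sesq I A v u)"
    using im0[of u] im0[of v] by (simp add: sesq_add_left sesq_add_right)
  have "Im (sesq I A (\<lambda>i. u i + \<i> * v i) (\<lambda>i. u i + \<i> * v i)) = 0" by (rule im0)
  then have 2: "Re (sesq I A u v) = Re (sesq I A v u)"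
    using im0[of u] im0[of v]
    by (simp add: sesq_add_left sesq_add_right sesq_scale_left sesq_scale_right)
  show ?thesis using 1 2 by (simp add: complex_eq_iff)
qed

text \<open>Cauchy-Schwarz for an operator between 0 and the identity, read off from positivity at a
  single well-chosen vector. The degenerate cases are split off because a phase and a cancellation
  are needed.\<close>

lemma pos_form_op_bound:
  assumes fin: "finite I" and pos: "pos_form I A"
    and le: "\<And>v. Re (sesq I A v v) \<le> (nrm I v)\<^sup>2"
  shows "op_bound I A 1"
  unfolding op_bound_def
proof (intro conjI allI)
  fix u v
  let ?a = "nrm I u" and ?b = "nrm I v" and ?q = "sesq I A u v"
  show "cmod ?q \<le> 1 * (?a * ?b)"
  proof (cases "?a = 0 \<or> ?b = 0 \<or> ?q = 0")
    case True
    then consider "\<forall>i\<in>I. u i = 0" | "\<forall>i\<in>I. v i = 0" | "?q = 0"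
      using nrm_eq_0[OF fin] by blast
    then have "?q = 0" by cases (simp_all add: sesq_def)
    then show ?thesis by simp
  next
    case False
    then have pos_ab: "?a > 0" "?b > 0" "?q \<noteq> 0"
      using nrm_nonneg[of I u] nrm_nonneg[of I v] by linarith+
    \<comment> \<open>The phase that rotates \<open>?q\<close> onto the positive real axis.\<close>
    define c where "c = cnj ?q / of_real (cmod ?q)"
    have c1: "cmod c = 1" using pos_ab by (simp add: c_def norm_divide)
    have "?q * cnj ?q = of_real ((cmod ?q)\<^sup>2)" by (metis complex_norm_square)
    then have cq: "c * ?q = of_real (cmod ?q)"
      using pos_ab by (simp add: c_def field_simps power2_eq_square)
    \<comment> \<open>Both vectors are scaled to the norm \<open>?a * ?b\<close>, so that the two
      diagonal terms are bounded alike, and the sign of \<open>y\<close> makes the cross term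
      negative.\<close>
    define x where "x = (\<lambda>i. of_real ?b * u i)"
    define y where "y = (\<lambda>i. - (of_real ?a * c) * v i)"
    have nx: "(nrm I x)\<^sup>2 = (?a * ?b)\<^sup>2" "(nrm I y)\<^sup>2 = (?a * ?b)\<^sup>2"
      unfolding x_def y_def nrm_scale using c1 by (auto simp: norm_mult power_mult_distrib)
    have xy: "sesq I A x y = - of_real (?a * ?b * cmod ?q)"
      unfolding x_def y_def sesq_scale_left sesq_scale_right using cq by (simp add: mult_ac)
    have "0 \<le> Re (sesq I A (\<lambda>i. x i + y i) (\<lambda>i. x i + y i))"
      using pos by (simp add: pos_form_def less_eq_complex_def)
    also have "\<dots> = Re (sesq I A x x) + Re (sesq I A y y) + 2 * Re (sesq I A x y)"
      using pos_form_hermitian[OF pos, of y x] by (simp add: sesq_add_left sesq_add_right)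
    also have "\<dots> \<le> 2 * (?a * ?b)\<^sup>2 - 2 * (?a * ?b * cmod ?q)"
      using le[of x] le[of y] nx xy by simp
    finally have "(?a * ?b) * cmod ?q \<le> (?a * ?b) * (?a * ?b)"
      by (simp add: power2_eq_square)
    then show ?thesis using pos_ab by (simp add: mult_le_cancel_left)
  qed
qed simp

text \<open>Pairing the second factor with \<open>Y\<close> costs the factor \<open>t\<close>, because the partial matrix
  element \<open>\<langle>u|U|v\<rangle>\<close> is a bounded operator on that factor; no singular values are needed.\<close>

lemma trace_bound_times:
  assumes X: "trace_bound I X s" and Y: "trace_bound J Y t" and "0 \<le> t"
  shows "trace_bound (I \<times> J) (\<lambda>(i, j) (i', j'). X i i' * Y j j') (s * t)"
  unfolding trace_bound_def
proof (intro allI impI)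
  fix U c assume U: "op_bound (I \<times> J) U c"
  \<comment> \<open>\<open>V\<close> is the partial trace over \<open>J\<close> of \<open>U\<close>
    multiplied by \<open>Y\<close> on the second factor, so pairing \<open>X\<close> with
    \<open>V\<close> equals pairing the tensor product with \<open>U\<close>.\<close>
  define V where "V = (\<lambda>i' i. \<Sum>j\<in>J. \<Sum>j'\<in>J. Y j j' * U (i', j') (i, j))"
  have "op_bound I V (t * c)"
    unfolding op_bound_def
  proof (intro conjI allI)
    show "0 \<le> t * c" using U \<open>0 \<le> t\<close> by (simp add: op_bound_def)
    fix u v
    define W where "W = (\<lambda>j' j. \<Sum>i'\<in>I. \<Sum>i\<in>I. cnj (u i') * U (i', j') (i, j) * v i)"
    have "op_bound J W (c * (nrm I u * nrm I v))"
      unfolding op_bound_def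
    proof (intro conjI allI)
      show "0 \<le> c * (nrm I u * nrm I v)" using U by (simp add: op_bound_def)
      fix u' v'
      have "sesq J W u' v' = (\<Sum>j'\<in>J. \<Sum>j\<in>J. \<Sum>i'\<in>I. \<Sum>i\<in>I.
          cnj (u i' * u' j') * U (i', j') (i, j) * (v i * v' j))"
        unfolding sesq_def W_def by (simp add: sum_distrib_left sum_distrib_right mult_ac)
      also have "\<dots> = (\<Sum>j'\<in>J. \<Sum>i'\<in>I. \<Sum>j\<in>J. \<Sum>i\<in>I.
          cnj (u i' * u' j') * U (i', j') (i, j) * (v i * v' j))"
        by (intro sum.cong refl sum.swap)
      also have "\<dots> = (\<Sum>i'\<in>I. \<Sum>j'\<in>J. \<Sum>i\<in>I. \<Sum>j\<in>J.
          cnj (u i' * u' j') * U (i', j') (i, j) * (v i * v' j))"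
        by (subst sum.swap) (intro sum.cong refl sum.swap)
      also have "\<dots> = sesq (I \<times> J) U (\<lambda>(i, j). u i * u' j) (\<lambda>(i, j). v i * v' j)"
        unfolding sesq_def sum.cartesian_product' by simp
      finally have *: "sesq J W u' v' = \<dots>" .
      \<comment> \<open>The form of \<open>W\<close> is the form of \<open>U\<close> on product
        vectors, whose norms multiply.\<close>
      have "cmod (sesq J W u' v') \<le> c * ((nrm I u * nrm J u') * (nrm I v * nrm J v'))"
        unfolding * using U unfolding op_bound_def nrm_times[symmetric] by blast
      then show "cmod (sesq J W u' v') \<le> c * (nrm I u * nrm I v) * (nrm J u' * nrm J v')"
        by (simp add: mult_ac)
    qed
    then have "cmod (tr_prod J Y W) \<le> t * (c * (nrm I u * nrm I v))"
      using Y by (simp add: trace_bound_def)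
    moreover have "tr_prod J Y W = sesq I V u v"
    proof -
      have "tr_prod J Y W = (\<Sum>j\<in>J. \<Sum>j'\<in>J. \<Sum>i'\<in>I. \<Sum>i\<in>I.
          cnj (u i') * (Y j j' * U (i', j') (i, j)) * v i)"
        unfolding tr_prod_def W_def by (simp add: sum_distrib_left mult_ac)
      also have "\<dots> = (\<Sum>j\<in>J. \<Sum>i'\<in>I. \<Sum>i\<in>I. \<Sum>j'\<in>J.
          cnj (u i') * (Y j j' * U (i', j') (i, j)) * v i)"
        by (simp only: sum.swap[of _ I J])
      also have "\<dots> = (\<Sum>i'\<in>I. \<Sum>i\<in>I. \<Sum>j\<in>J. \<Sum>j'\<in>J.
          cnj (u i') * (Y j j' * U (i', j') (i, j)) * v i)"
        by (simp only: sum.swap[of _ I J])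
      also have "\<dots> = sesq I V u v"
        unfolding sesq_def V_def by (simp add: sum_distrib_left sum_distrib_right)
      finally show ?thesis .
    qed
    ultimately show "cmod (sesq I V u v) \<le> t * c * (nrm I u * nrm I v)"
      by (simp add: mult_ac)
  qed
  then have "cmod (tr_prod I X V) \<le> s * (t * c)"
    using X by (simp add: trace_bound_def)
  moreover have "tr_prod I X V = tr_prod (I \<times> J) (\<lambda>(i, j) (i', j'). X i i' * Y j j') U"
  proof -
    have "tr_prod I X V = (\<Sum>i\<in>I. \<Sum>i'\<in>I. \<Sum>j\<in>J. \<Sum>j'\<in>J. X i i' * Y j j' * U (i', j') (i, j))"
      unfolding tr_prod_def V_def by (simp add: sum_distrib_left mult_ac)
    also have "\<dots> = (\<Sum>i\<in>I. \<Sum>j\<in>J. \<Sum>i'\<in>I. \<Sum>j'\<in>J. X i i' * Y j j' * U (i', j') (i, j))"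
      by (intro sum.cong refl sum.swap)
    finally show ?thesis
      unfolding tr_prod_def sum.cartesian_product' by simp
  qed
  ultimately show "cmod (tr_prod (I \<times> J) (\<lambda>(i, j) (i', j'). X i i' * Y j j') U) \<le> s * t * c"
    by (simp add: mult_ac)
qed

section \<open>Change of the index set\<close>

lemma sesq_reindex:
  "bij_betw h I I' \<Longrightarrow> sesq I (\<lambda>i j. A (h i) (h j)) (\<lambda>i. u (h i)) (\<lambda>i. v (h i)) = sesq I' A u v"
  unfolding sesq_def by (subst (1 2) sum.reindex_bij_betw[symmetric]) auto

lemma pos_form_reindex:
  assumes h: "bij_betw h I I'" and pos: "pos_form I' A"
  shows "pos_form I (\<lambda>i j. A (h i) (h j))"
  unfolding pos_form_def
proof
  fix v
  \<comment> \<open>Reindexing applies to vectors pulled back along \<open>h\<close>, so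
    \<open>v\<close> is first written as such a pullback.\<close>
  have "sesq I (\<lambda>i j. A (h i) (h j)) v v
      = sesq I (\<lambda>i j. A (h i) (h j)) (\<lambda>i. v (inv_into I h (h i))) (\<lambda>i. v (inv_into I h (h i)))"
    unfolding sesq_def using h by (intro sum.cong refl) (simp add: bij_betw_def inv_into_f_f)
  also have "\<dots> = sesq I' A (\<lambda>i. v (inv_into I h i)) (\<lambda>i. v (inv_into I h i))"
    by (rule sesq_reindex[OF h])
  finally show "0 \<le> sesq I (\<lambda>i j. A (h i) (h j)) v v"
    using pos by (simp add: pos_form_def)
qed

lemma trace_bound_reindex:
  assumes h: "bij_betw h I I'" and X: "trace_bound I' X s"
  shows "trace_bound I (\<lambda>i j. X (h i) (h j)) s"
  unfolding trace_bound_def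
proof (intro allI impI)
  fix U c assume U: "op_bound I U c"
  define g where "g = inv_into I h"
  have gh: "g (h i) = i" if "i \<in> I" for i
    using h that by (simp add: g_def bij_betw_def)
  have g: "bij_betw g I' I" unfolding g_def using h by (rule bij_betw_inv_into)
  have "op_bound I' (\<lambda>i j. U (g i) (g j)) c"
    unfolding op_bound_def
  proof (intro conjI allI)
    show "0 \<le> c" using U by (simp add: op_bound_def)
    fix u v
    have hg: "h (g i) = i" if "i \<in> I'" for i
      using h that unfolding g_def by (rule bij_betw_inv_into_right)
    have nr: "nrm I (\<lambda>i. w (h i)) = nrm I' w" for w
      using sum.reindex_bij_betw[OF h, of "\<lambda>i. (cmod (w i))\<^sup>2"] by (simp add: nrm_def)
    have "sesq I' (\<lambda>i j. U (g i) (g j)) u v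
        = sesq I' (\<lambda>i j. U (g i) (g j)) (\<lambda>i. u (h (g i))) (\<lambda>i. v (h (g i)))"
      unfolding sesq_def using hg by simp
    also have "\<dots> = sesq I U (\<lambda>i. u (h i)) (\<lambda>i. v (h i))"
      by (rule sesq_reindex[OF g])
    finally show "cmod (sesq I' (\<lambda>i j. U (g i) (g j)) u v) \<le> c * (nrm I' u * nrm I' v)"
      using U by (simp add: op_bound_def flip: nr)
  qed
  then have "cmod (tr_prod I' X (\<lambda>i j. U (g i) (g j))) \<le> s * c"
    using X by (simp add: trace_bound_def)
  moreover have "tr_prod I' X (\<lambda>i j. U (g i) (g j)) = tr_prod I (\<lambda>i j. X (h i) (h j)) U"
  proof -
    have "tr_prod I' X (\<lambda>i j. U (g i) (g j))
        = (\<Sum>i\<in>I. \<Sum>j\<in>I. X (h i) (h j) * U (g (h j)) (g (h i)))"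
      unfolding tr_prod_def by (subst (1 2) sum.reindex_bij_betw[OF h, symmetric]) auto
    also have "\<dots> = tr_prod I (\<lambda>i j. X (h i) (h j)) U"
      unfolding tr_prod_def by (intro sum.cong refl) (simp add: gh)
    finally show ?thesis .
  qed
  ultimately show "cmod (tr_prod I (\<lambda>i j. X (h i) (h j)) U) \<le> s * c" by simp
qed

lemma trace_bound_cong:
  "trace_bound I X s \<Longrightarrow> (\<And>i j. i \<in> I \<Longrightarrow> j \<in> I \<Longrightarrow> X i j = Y i j) \<Longrightarrow> trace_bound I Y s"
  by (auto simp: trace_bound_def tr_prod_def)

section \<open>Positive matrices and partial transposition\<close>

abbreviation entries :: "complex mat \<Rightarrow> nat \<Rightarrow> nat \<Rightarrow> complex" where
  "entries A \<equiv> \<lambda>i j. A $$ (i, j)"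

text \<open>\<open>\<bullet>c\<close> conjugates its second argument, which therefore becomes the
  left argument of \<open>sesq\<close>.\<close>

lemma psd_iff_pos_form:
  "psd d A \<longleftrightarrow> A \<in> carrier_mat d d \<and> pos_form {..<d} (entries A)"
proof -
  have eq: "(A *\<^sub>v v) \<bullet>c v = sesq {..<d} (entries A) (($) v) (($) v)"
    if "A \<in> carrier_mat d d" "v \<in> carrier_vec d" for v
  proof -
    have "(A *\<^sub>v v) \<bullet>c v = (\<Sum>i<d. (\<Sum>j<d. A $$ (i, j) * v $ j) * cnj (v $ i))"
      using that by (auto simp: scalar_prod_def atLeast0LessThan intro!: sum.cong)
    then show ?thesis by (simp add: sesq_def sum_distrib_left sum_distrib_right mult_ac)
  qed
  have "sesq {..<d} (entries A) (($) (vec d v)) (($) (vec d v)) = sesq {..<d} (entries A) v v" for v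
    by (simp add: sesq_def)
  then show ?thesis
    unfolding psd_def pos_form_def by (metis eq vec_carrier)
qed

lemma psd_carrier: "psd d A \<Longrightarrow> A \<in> carrier_mat d d"
  by (simp add: psd_def)

lemma mat_trace_mult:
  assumes "A \<in> carrier_mat d d" "B \<in> carrier_mat d d"
  shows "mat_trace (A * B) = tr_prod {..<d} (entries A) (entries B)"
  using assms by (auto simp: mat_trace_def tr_prod_def scalar_prod_def atLeast0LessThan intro!: sum.cong)

lemma mat_trace_add:
  "A \<in> carrier_mat d d \<Longrightarrow> B \<in> carrier_mat d d \<Longrightarrow> mat_trace (A + B) = mat_trace A + mat_trace B"
  by (simp add: mat_trace_def sum.distrib)

lemma mat_trace_smult: "A \<in> carrier_mat d d \<Longrightarrow> mat_trace (c \<cdot>\<^sub>m A) = c * mat_trace A"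
  by (simp add: mat_trace_def sum_distrib_left)

lemma psd_trace_nonneg:
  assumes "psd d A"
  shows "0 \<le> mat_trace A"
proof -
  have pos: "pos_form {..<d} (entries A)" and car: "A \<in> carrier_mat d d"
    using assms by (auto simp: psd_iff_pos_form)
  have "0 \<le> A $$ (i, i)" if "i < d" for i
    using pos sesq_unit[of "{..<d}" i i "entries A"] that unfolding pos_form_def
    by (metis finite_lessThan lessThan_iff)
  then show ?thesis unfolding mat_trace_def using car by (auto intro!: sum_nonneg)
qed

text \<open>The form of the transpose at \<open>v\<close> is the form of \<open>A\<close> at the
  conjugate of \<open>v\<close>.\<close>

lemma psd_transpose:
  assumes "psd d A"
  shows "psd d (transpose_mat A)"
  unfolding psd_iff_pos_form pos_form_def
proof (intro conjI allI)
  have A: "A \<in> carrier_mat d d" using assms by (rule psd_carrier)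
  then show "transpose_mat A \<in> carrier_mat d d" by simp
  fix v
  have "sesq {..<d} (entries (transpose_mat A)) v v
      = sesq {..<d} (entries A) (\<lambda>i. cnj (v i)) (\<lambda>i. cnj (v i))"
    unfolding sesq_def using A by (subst sum.swap) (simp add: mult_ac)
  then show "0 \<le> sesq {..<d} (entries (transpose_mat A)) v v"
    using assms by (simp add: psd_iff_pos_form pos_form_def)
qed

lemma psd_permute:
  assumes f: "bij_betw f {..<d} {..<d'}" and A: "psd d' A"
  shows "psd d (mat d d (\<lambda>(i, j). A $$ (f i, f j)))"
proof -
  have "sesq {..<d} (entries (mat d d (\<lambda>(i, j). A $$ (f i, f j)))) v v
      = sesq {..<d} (\<lambda>i j. A $$ (f i, f j)) v v" for v
    by (rule sesq_cong) simp
  moreover have "pos_form {..<d} (\<lambda>i j. A $$ (f i, f j))"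
    using A by (intro pos_form_reindex[OF f]) (simp add: psd_iff_pos_form)
  ultimately show ?thesis by (simp add: psd_iff_pos_form pos_form_def)
qed

section \<open>Index arithmetic of product bases\<close>

lemma pair_index_less: "a < m \<Longrightarrow> b < k \<Longrightarrow> a * k + b < m * (k::nat)"
  by (metis add.commute add_mult_distrib less_le_trans mult.commute mult_le_mono1
      nat_add_left_cancel_less One_nat_def Suc_leI mult_1 plus_1_eq_Suc)

lemma div_less_factor: "r < m * k \<Longrightarrow> r div k < (m::nat)"
  by (simp add: less_mult_imp_div_less)

lemma factor_pos: "r < m * k \<Longrightarrow> 0 < (k::nat)"
  by (cases k) auto

lemma pair_index_div_mod [simp]:
  assumes "b < k"
  shows "(a * k + b) div k = a" "(a * k + b) mod k = (b::nat)"
  using assms by auto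

lemma swap_factors_bij:
  "bij_betw (\<lambda>r. (r mod k) * d + r div k) {..<d * k} {..<k * (d::nat)}"
proof (rule bij_betw_byWitness[where f' = "\<lambda>r. (r mod d) * k + r div d"])
  show "\<forall>r\<in>{..<d * k}. ((r mod k * d + r div k) mod d) * k + (r mod k * d + r div k) div d = r"
    by (auto simp: div_less_factor)
  show "\<forall>r\<in>{..<k * d}. ((r mod d * k + r div d) mod k) * d + (r mod d * k + r div d) div k = r"
    by (auto simp: div_less_factor)
  show "(\<lambda>r. r mod k * d + r div k) ` {..<d * k} \<subseteq> {..<k * d}"
    using factor_pos by (auto intro!: pair_index_less div_less_factor)
  show "(\<lambda>r. r mod d * k + r div d) ` {..<k * d} \<subseteq> {..<d * k}"
    using factor_pos by (auto intro!: pair_index_less div_less_factor)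
qed

text \<open>Complete positivity is stated with the map on the left factor; exchanging the tensor
  factors before and after carries it over to the right one.\<close>

lemma map_right_psd:
  assumes cp: "completely_positive d d' \<Phi>" and X: "psd (k * d) X"
  shows "psd (k * d') (map_right k d d' \<Phi> X)"
proof -
  define Y where "Y = mat (d * k) (d * k)
      (\<lambda>(i, j). X $$ ((i mod k) * d + i div k, (j mod k) * d + j div k))"
  have "psd (d * k) Y"
    unfolding Y_def by (rule psd_permute[OF swap_factors_bij X])
  then have "psd (d' * k) (map_left d d' k \<Phi> Y)"
    using cp by (auto simp: completely_positive_def)
  then have *: "psd (k * d') (mat (k * d') (k * d') (\<lambda>(i, j). map_left d d' k \<Phi> Y $$
      ((i mod d') * k + i div d', (j mod d') * k + j div d')))"
    by (rule psd_permute[OF swap_factors_bij])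
  have "map_left d d' k \<Phi> Y $$ ((r mod d') * k + r div d', (s mod d') * k + s div d')
      = map_right k d d' \<Phi> X $$ (r, s)" if rs: "r < k * d'" "s < k * d'" for r s
  proof -
    have lt: "r div d' < k" "s div d' < k" "r mod d' < d'" "s mod d' < d'"
      using rs factor_pos[OF rs(1)] by (auto intro: div_less_factor)
    have "mat d d (\<lambda>(a, a'). Y $$ (a * k + r div d', a' * k + s div d'))
        = mat d d (\<lambda>(b, b'). X $$ ((r div d') * d + b, (s div d') * d + b'))"
      using lt by (auto simp: Y_def pair_index_less)
    then show ?thesis using rs lt by (simp add: map_left_def map_right_def pair_index_less)
  qed
  then have "mat (k * d') (k * d') (\<lambda>(i, j). map_left d d' k \<Phi> Y $$
      ((i mod d') * k + i div d', (j mod d') * k + j div d')) = map_right k d d' \<Phi> X"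
    by (intro eq_matI) (auto simp: map_right_def)
  then show ?thesis using * by simp
qed

section \<open>Partial transposition as a permutation of index pairs\<close>

lemma partial_transpose_carrier [simp]:
  "partial_transpose p dA dB X \<in> carrier_mat (dA * dB) (dA * dB)"
  by (cases p) auto

lemma dim_partial_transpose [simp]:
  "dim_row (partial_transpose p dA dB X) = dA * dB"
  "dim_col (partial_transpose p dA dB X) = dA * dB"
  using carrier_matD[OF partial_transpose_carrier[of p dA dB X]] by simp_all

text \<open>Treats both parties at once: later arguments need little more than that this is an
  involution on index pairs commuting with the exchange of row and column.\<close>

definition pt_index :: "party \<Rightarrow> nat \<Rightarrow> nat \<times> nat \<Rightarrow> nat \<times> nat" where
  "pt_index p k = (\<lambda>(r, s). case p of
     Alice \<Rightarrow> ((s div k) * k + r mod k, (r div k) * k + s mod k)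
   | Bob \<Rightarrow> ((r div k) * k + s mod k, (s div k) * k + r mod k))"

lemma partial_transpose_entry:
  "r < dA * dB \<Longrightarrow> s < dA * dB \<Longrightarrow>
    partial_transpose p dA dB X $$ (r, s) = X $$ pt_index p dB (r, s)"
  by (cases p) (auto simp: pt_index_def)

lemma pt_index_swap: "pt_index p k (s, r) = prod.swap (pt_index p k (r, s))"
  by (cases p) (auto simp: pt_index_def)

lemma pt_index_involution:
  assumes "r < m * k" "s < m * k"
  shows "pt_index p k (pt_index p k (r, s)) = (r, s)"
  using factor_pos[OF assms(1)] by (cases p) (auto simp: pt_index_def)

lemma pt_index_range:
  assumes "r < m * k" "s < m * k"
  shows "fst (pt_index p k (r, s)) < m * k" "snd (pt_index p k (r, s)) < m * k"
  using assms factor_pos[OF assms(1)]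
  by (cases p; auto simp: pt_index_def intro!: pair_index_less div_less_factor)+

lemma pt_index_bij: "bij_betw (pt_index p k) ({..<m * k} \<times> {..<m * k}) ({..<m * k} \<times> {..<m * k})"
proof (rule bij_betw_byWitness[where f' = "pt_index p k"])
  show "pt_index p k ` ({..<m * k} \<times> {..<m * k}) \<subseteq> {..<m * k} \<times> {..<m * k}"
  proof
    fix q assume "q \<in> pt_index p k ` ({..<m * k} \<times> {..<m * k})"
    then obtain r s where "r < m * k" "s < m * k" "q = pt_index p k (r, s)" by auto
    then show "q \<in> {..<m * k} \<times> {..<m * k}"
      using pt_index_range[of r m k s p] by (simp add: mem_Times_iff)
  qed
  then show "pt_index p k ` ({..<m * k} \<times> {..<m * k}) \<subseteq> {..<m * k} \<times> {..<m * k}" .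
qed (auto simp: pt_index_involution)

text \<open>The trace of a product sums over all index pairs the entry of \<open>X\<close> at a pair
  times the entry of \<open>Y\<close> at the exchanged pair. Partial transposition permutes the
  pairs compatibly with the exchange, so it only reorders the sum.\<close>

lemma tr_prod_partial_transpose:
  "tr_prod {..<dA * dB} (entries (partial_transpose p dA dB X)) (entries (partial_transpose p dA dB Y))
    = tr_prod {..<dA * dB} (entries X) (entries Y)"
proof -
  let ?I = "{..<dA * dB}"
  have "tr_prod ?I (entries (partial_transpose p dA dB X)) (entries (partial_transpose p dA dB Y))
      = (\<Sum>q\<in>?I \<times> ?I. X $$ pt_index p dB q * Y $$ prod.swap (pt_index p dB q))"
    unfolding tr_prod_def sum.cartesian_product'
  proof (intro sum.cong refl)
    fix r s assume rs: "r \<in> ?I" "s \<in> ?I"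
    show "partial_transpose p dA dB X $$ (r, s) * partial_transpose p dA dB Y $$ (s, r)
        = X $$ pt_index p dB (r, s) * Y $$ prod.swap (pt_index p dB (r, s))"
      using rs by (simp add: partial_transpose_entry flip: pt_index_swap)
  qed
  also have "\<dots> = (\<Sum>q\<in>?I \<times> ?I. X $$ q * Y $$ prod.swap q)"
    by (rule sum.reindex_bij_betw[OF pt_index_bij])
  also have "\<dots> = tr_prod ?I (entries X) (entries Y)"
    unfolding tr_prod_def sum.cartesian_product' by simp
  finally show ?thesis .
qed

lemma partial_transpose_involution:
  assumes "X \<in> carrier_mat (dA * dB) (dA * dB)"
  shows "partial_transpose p dA dB (partial_transpose p dA dB X) = X"
proof (rule eq_matI)
  fix r s assume "r < dim_row X" "s < dim_col X"
  then have rs: "r < dA * dB" "s < dA * dB" using assms by auto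
  obtain r' s' where q: "pt_index p dB (r, s) = (r', s')" by (cases "pt_index p dB (r, s)")
  then have "r' < dA * dB" "s' < dA * dB" using pt_index_range[OF rs, of p] by auto
  then show "partial_transpose p dA dB (partial_transpose p dA dB X) $$ (r, s) = X $$ (r, s)"
    using rs pt_index_involution[OF rs, of p] q by (simp add: partial_transpose_entry)
qed (use assms in auto)

lemma partial_transpose_other_party:
  "partial_transpose Alice dA dB X = transpose_mat (partial_transpose Bob dA dB X)"
  "partial_transpose Bob dA dB X = transpose_mat (partial_transpose Alice dA dB X)"
  by (rule eq_matI; simp)+

lemma psd_partial_transpose_party:
  "psd d (partial_transpose p dA dB X) \<Longrightarrow> psd d (partial_transpose p' dA dB X)"
  by (cases p; cases p') (metis partial_transpose_other_party psd_transpose)+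

text \<open>\<open>\<Phi>\<close> acts separately on blocks labelled by Bob's row and column index,
  and transposing Bob's system merely exchanges these labels.\<close>

lemma map_left_partial_transpose:
  "map_left dA d' dB \<Phi> (partial_transpose Bob dA dB X) = partial_transpose Bob d' dB (map_left dA d' dB \<Phi> X)"
proof (rule eq_matI)
  fix r s
  assume "r < dim_row (partial_transpose Bob d' dB (map_left dA d' dB \<Phi> X))"
    "s < dim_col (partial_transpose Bob d' dB (map_left dA d' dB \<Phi> X))"
  then have rs: "r < d' * dB" "s < d' * dB" by simp_all
  then have lt: "r div dB < d'" "s div dB < d'" "r mod dB < dB" "s mod dB < dB"
    using factor_pos[OF rs(1)] by (auto intro: div_less_factor)
  have "mat dA dA (\<lambda>(a, a'). partial_transpose Bob dA dB X $$ (a * dB + r mod dB, a' * dB + s mod dB))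
      = mat dA dA (\<lambda>(a, a'). X $$ (a * dB + s mod dB, a' * dB + r mod dB))"
    using lt by (auto simp: pair_index_less)
  then show "map_left dA d' dB \<Phi> (partial_transpose Bob dA dB X) $$ (r, s)
      = partial_transpose Bob d' dB (map_left dA d' dB \<Phi> X) $$ (r, s)"
    using rs lt by (simp add: map_left_def pair_index_less)
qed (simp_all add: map_left_def)

lemma map_right_partial_transpose:
  "map_right dA dB d' \<Phi> (partial_transpose Alice dA dB X)
    = partial_transpose Alice dA d' (map_right dA dB d' \<Phi> X)"
proof (rule eq_matI)
  fix r s
  assume "r < dim_row (partial_transpose Alice dA d' (map_right dA dB d' \<Phi> X))"
    "s < dim_col (partial_transpose Alice dA d' (map_right dA dB d' \<Phi> X))"
  then have rs: "r < dA * d'" "s < dA * d'" by simp_all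
  then have lt: "r div d' < dA" "s div d' < dA" "r mod d' < d'" "s mod d' < d'"
    using factor_pos[OF rs(1)] by (auto intro: div_less_factor)
  have "mat dB dB (\<lambda>(b, b'). partial_transpose Alice dA dB X $$ ((r div d') * dB + b, (s div d') * dB + b'))
      = mat dB dB (\<lambda>(b, b'). X $$ ((s div d') * dB + b, (r div d') * dB + b'))"
    using lt by (auto simp: pair_index_less)
  then show "map_right dA dB d' \<Phi> (partial_transpose Alice dA dB X) $$ (r, s)
      = partial_transpose Alice dA d' (map_right dA dB d' \<Phi> X) $$ (r, s)"
    using rs lt by (simp add: map_right_def pair_index_less)
qed (simp_all add: map_right_def)

lemma mat_trace_partial_transpose:
  assumes "X \<in> carrier_mat (dA * dB) (dA * dB)"
  shows "mat_trace (partial_transpose p dA dB X) = mat_trace X"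
  unfolding mat_trace_def using assms
  by (cases p) (auto intro!: sum.cong)

section \<open>Linearity of LOCC protocols and positivity on transposed inputs\<close>

lemma completely_positive_linear:
  assumes "completely_positive d d' \<Phi>"
  shows "X \<in> carrier_mat d d \<Longrightarrow> \<Phi> X \<in> carrier_mat d' d'"
    and "X \<in> carrier_mat d d \<Longrightarrow> Y \<in> carrier_mat d d \<Longrightarrow> \<Phi> (X + Y) = \<Phi> X + \<Phi> Y"
    and "X \<in> carrier_mat d d \<Longrightarrow> \<Phi> (c \<cdot>\<^sub>m X) = c \<cdot>\<^sub>m \<Phi> X"
  using assms by (auto simp: completely_positive_def)

lemma map_left_carrier [simp]: "map_left d d' k \<Phi> X \<in> carrier_mat (d' * k) (d' * k)"
  by (simp add: map_left_def)

lemma map_right_carrier [simp]: "map_right k d d' \<Phi> X \<in> carrier_mat (k * d') (k * d')"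
  by (simp add: map_right_def)

lemma map_left_add:
  assumes cp: "completely_positive d d' \<Phi>"
    and X: "X \<in> carrier_mat (d * k) (d * k)" and Y: "Y \<in> carrier_mat (d * k) (d * k)"
  shows "map_left d d' k \<Phi> (X + Y) = map_left d d' k \<Phi> X + map_left d d' k \<Phi> Y"
proof (rule eq_matI)
  fix r s
  assume "r < dim_row (map_left d d' k \<Phi> X + map_left d d' k \<Phi> Y)"
    "s < dim_col (map_left d d' k \<Phi> X + map_left d d' k \<Phi> Y)"
  then have rs: "r < d' * k" "s < d' * k" by (simp_all add: map_left_def)
  then have lt: "r div k < d'" "s div k < d'" "r mod k < k" "s mod k < k"
    using factor_pos[OF rs(1)] by (auto intro: div_less_factor)
  define B where "B Z = mat d d (\<lambda>(a, a'). Z $$ (a * k + r mod k, a' * k + s mod k))"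
    for Z :: "complex mat"
  have B: "B Z \<in> carrier_mat d d" for Z by (simp add: B_def)
  have "B (X + Y) = B X + B Y"
    using X Y lt by (auto simp: B_def pair_index_less)
  then have "\<Phi> (B (X + Y)) = \<Phi> (B X) + \<Phi> (B Y)"
    using completely_positive_linear(2)[OF cp B B] by simp
  then show "map_left d d' k \<Phi> (X + Y) $$ (r, s) = (map_left d d' k \<Phi> X + map_left d d' k \<Phi> Y) $$ (r, s)"
    using rs lt carrier_matD[OF completely_positive_linear(1)[OF cp B[of Y]]]
    by (simp add: map_left_def B_def)
qed (simp_all add: map_left_def)

lemma map_left_smult:
  assumes cp: "completely_positive d d' \<Phi>" and X: "X \<in> carrier_mat (d * k) (d * k)"
  shows "map_left d d' k \<Phi> (c \<cdot>\<^sub>m X) = c \<cdot>\<^sub>m map_left d d' k \<Phi> X"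
proof (rule eq_matI)
  fix r s
  assume "r < dim_row (c \<cdot>\<^sub>m map_left d d' k \<Phi> X)" "s < dim_col (c \<cdot>\<^sub>m map_left d d' k \<Phi> X)"
  then have rs: "r < d' * k" "s < d' * k" by (simp_all add: map_left_def)
  then have lt: "r div k < d'" "s div k < d'" "r mod k < k" "s mod k < k"
    using factor_pos[OF rs(1)] by (auto intro: div_less_factor)
  define B where "B Z = mat d d (\<lambda>(a, a'). Z $$ (a * k + r mod k, a' * k + s mod k))"
    for Z :: "complex mat"
  have B: "B Z \<in> carrier_mat d d" for Z by (simp add: B_def)
  have "B (c \<cdot>\<^sub>m X) = c \<cdot>\<^sub>m B X"
    using X lt by (auto simp: B_def pair_index_less)
  then have "\<Phi> (B (c \<cdot>\<^sub>m X)) = c \<cdot>\<^sub>m \<Phi> (B X)"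
    using completely_positive_linear(3)[OF cp B] by simp
  then show "map_left d d' k \<Phi> (c \<cdot>\<^sub>m X) $$ (r, s) = (c \<cdot>\<^sub>m map_left d d' k \<Phi> X) $$ (r, s)"
    using rs lt carrier_matD[OF completely_positive_linear(1)[OF cp B[of X]]]
    by (simp add: map_left_def B_def)
qed (simp_all add: map_left_def)

lemma map_right_add:
  assumes cp: "completely_positive d d' \<Phi>"
    and X: "X \<in> carrier_mat (k * d) (k * d)" and Y: "Y \<in> carrier_mat (k * d) (k * d)"
  shows "map_right k d d' \<Phi> (X + Y) = map_right k d d' \<Phi> X + map_right k d d' \<Phi> Y"
proof (rule eq_matI)
  fix r s
  assume "r < dim_row (map_right k d d' \<Phi> X + map_right k d d' \<Phi> Y)"
    "s < dim_col (map_right k d d' \<Phi> X + map_right k d d' \<Phi> Y)"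
  then have rs: "r < k * d'" "s < k * d'" by (simp_all add: map_right_def)
  then have lt: "r div d' < k" "s div d' < k" "r mod d' < d'" "s mod d' < d'"
    using factor_pos[OF rs(1)] by (auto intro: div_less_factor)
  define B where "B Z = mat d d (\<lambda>(b, b'). Z $$ ((r div d') * d + b, (s div d') * d + b'))"
    for Z :: "complex mat"
  have B: "B Z \<in> carrier_mat d d" for Z by (simp add: B_def)
  have "B (X + Y) = B X + B Y"
    using X Y lt by (auto simp: B_def pair_index_less)
  then have "\<Phi> (B (X + Y)) = \<Phi> (B X) + \<Phi> (B Y)"
    using completely_positive_linear(2)[OF cp B B] by simp
  then show "map_right k d d' \<Phi> (X + Y) $$ (r, s) = (map_right k d d' \<Phi> X + map_right k d d' \<Phi> Y) $$ (r, s)"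
    using rs lt carrier_matD[OF completely_positive_linear(1)[OF cp B[of Y]]]
    by (simp add: map_right_def B_def)
qed (simp_all add: map_right_def)

lemma map_right_smult:
  assumes cp: "completely_positive d d' \<Phi>" and X: "X \<in> carrier_mat (k * d) (k * d)"
  shows "map_right k d d' \<Phi> (c \<cdot>\<^sub>m X) = c \<cdot>\<^sub>m map_right k d d' \<Phi> X"
proof (rule eq_matI)
  fix r s
  assume "r < dim_row (c \<cdot>\<^sub>m map_right k d d' \<Phi> X)" "s < dim_col (c \<cdot>\<^sub>m map_right k d d' \<Phi> X)"
  then have rs: "r < k * d'" "s < k * d'" by (simp_all add: map_right_def)
  then have lt: "r div d' < k" "s div d' < k" "r mod d' < d'" "s mod d' < d'"
    using factor_pos[OF rs(1)] by (auto intro: div_less_factor)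
  define B where "B Z = mat d d (\<lambda>(b, b'). Z $$ ((r div d') * d + b, (s div d') * d + b'))"
    for Z :: "complex mat"
  have B: "B Z \<in> carrier_mat d d" for Z by (simp add: B_def)
  have "B (c \<cdot>\<^sub>m X) = c \<cdot>\<^sub>m B X"
    using X lt by (auto simp: B_def pair_index_less)
  then have "\<Phi> (B (c \<cdot>\<^sub>m X)) = c \<cdot>\<^sub>m \<Phi> (B X)"
    using completely_positive_linear(3)[OF cp B] by simp
  then show "map_right k d d' \<Phi> (c \<cdot>\<^sub>m X) $$ (r, s) = (c \<cdot>\<^sub>m map_right k d d' \<Phi> X) $$ (r, s)"
    using rs lt carrier_matD[OF completely_positive_linear(1)[OF cp B[of X]]]
    by (simp add: map_right_def B_def)
qed (simp_all add: map_right_def)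

text \<open>A measurement prescribes the protocol on states only. Linearity is what later extends
  the agreement to partially transposed inputs, which need not be positive.\<close>

lemma locc_protocol_add:
  "locc_protocol n dA dB P \<Longrightarrow> X \<in> carrier_mat (dA * dB) (dA * dB) \<Longrightarrow>
    Y \<in> carrier_mat (dA * dB) (dA * dB) \<Longrightarrow> P i (X + Y) = P i X + P i Y"
proof (induction arbitrary: X Y rule: locc_protocol.induct)
  case (announce k dA dB)
  then show ?case by (simp add: mat_trace_add)
next
  case (alice m dA e \<Phi> dB P)
  then have "P j i (map_left dA (e j) dB (\<Phi> j) (X + Y))
      = P j i (map_left dA (e j) dB (\<Phi> j) X) + P j i (map_left dA (e j) dB (\<Phi> j) Y)"
    if "j < m" for j
    using that by (simp add: instrument_def map_left_add)
  then show ?case by (simp add: sum.distrib)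
next
  case (bob m dB e \<Phi> dA P)
  then have "P j i (map_right dA dB (e j) (\<Phi> j) (X + Y))
      = P j i (map_right dA dB (e j) (\<Phi> j) X) + P j i (map_right dA dB (e j) (\<Phi> j) Y)"
    if "j < m" for j
    using that by (simp add: instrument_def map_right_add)
  then show ?case by (simp add: sum.distrib)
qed

lemma locc_protocol_smult:
  "locc_protocol n dA dB P \<Longrightarrow> X \<in> carrier_mat (dA * dB) (dA * dB) \<Longrightarrow> P i (c \<cdot>\<^sub>m X) = c * P i X"
proof (induction arbitrary: X rule: locc_protocol.induct)
  case (announce k dA dB)
  then show ?case by (simp add: mat_trace_smult)
next
  case (alice m dA e \<Phi> dB P)
  then have "P j i (map_left dA (e j) dB (\<Phi> j) (c \<cdot>\<^sub>m X)) = c * P j i (map_left dA (e j) dB (\<Phi> j) X)"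
    if "j < m" for j
    using that by (simp add: instrument_def map_left_smult)
  then show ?case by (simp add: sum_distrib_left)
next
  case (bob m dB e \<Phi> dA P)
  then have "P j i (map_right dA dB (e j) (\<Phi> j) (c \<cdot>\<^sub>m X)) = c * P j i (map_right dA dB (e j) (\<Phi> j) X)"
    if "j < m" for j
    using that by (simp add: instrument_def map_right_smult)
  then show ?case by (simp add: sum_distrib_left)
qed

text \<open>A map on one party commutes with transposing the other party, and whether a partial
  transpose is positive does not depend on the party that is transposed.\<close>

lemma locc_protocol_pt_nonneg:
  "locc_protocol n dA dB P \<Longrightarrow> X \<in> carrier_mat (dA * dB) (dA * dB) \<Longrightarrow>
    psd (dA * dB) (partial_transpose p dA dB X) \<Longrightarrow> 0 \<le> P i X"
\<comment> \<open>The party \<open>p\<close> is generalized because each round must transpose the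
  party that stays idle in it.\<close>
proof (induction arbitrary: X p rule: locc_protocol.induct)
  case (announce k dA dB)
  then show ?case
    using psd_trace_nonneg[OF announce.prems(2)] by (simp add: mat_trace_partial_transpose)
next
  case (alice m dA e \<Phi> dB P)
  have "0 \<le> P j i (map_left dA (e j) dB (\<Phi> j) X)" if j: "j < m" for j
  proof (rule alice.IH[OF j])
    have "psd (dA * dB) (partial_transpose Bob dA dB X)"
      using alice.prems(2) by (rule psd_partial_transpose_party)
    then show "psd (e j * dB) (partial_transpose Bob (e j) dB (map_left dA (e j) dB (\<Phi> j) X))"
      unfolding map_left_partial_transpose[symmetric]
      using alice.hyps(1) j by (auto simp: instrument_def completely_positive_def)
  qed simp
  then show ?case by (auto intro: sum_nonneg)
next
  case (bob m dB e \<Phi> dA P)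
  have "0 \<le> P j i (map_right dA dB (e j) (\<Phi> j) X)" if j: "j < m" for j
  proof (rule bob.IH[OF j])
    have "psd (dA * dB) (partial_transpose Alice dA dB X)"
      using bob.prems(2) by (rule psd_partial_transpose_party)
    then show "psd (dA * e j) (partial_transpose Alice dA (e j) (map_right dA dB (e j) (\<Phi> j) X))"
      unfolding map_right_partial_transpose[symmetric]
      using bob.hyps(1) j by (auto simp: instrument_def intro: map_right_psd)
  qed simp
  then show ?case by (auto intro: sum_nonneg)
qed

section \<open>LOCC measurements\<close>

definition herm :: "nat \<Rightarrow> complex mat \<Rightarrow> bool" where
  "herm d X \<longleftrightarrow> X \<in> carrier_mat d d \<and> (\<forall>r<d. \<forall>s<d. X $$ (s, r) = cnj (X $$ (r, s)))"

lemma herm_carrier: "herm d X \<Longrightarrow> X \<in> carrier_mat d d"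
  unfolding herm_def by blast

lemma herm_entry: "herm d X \<Longrightarrow> r < d \<Longrightarrow> s < d \<Longrightarrow> X $$ (s, r) = cnj (X $$ (r, s))"
  unfolding herm_def by blast

lemma herm_sesq_real:
  assumes "herm d X"
  shows "Im (sesq {..<d} (entries X) v v) = 0"
proof -
  have "sesq {..<d} (entries X) v v = sesq {..<d} (\<lambda>i j. cnj (X $$ (j, i))) v v"
    by (intro sesq_cong herm_entry[OF assms]) simp_all
  then have "sesq {..<d} (entries X) v v = cnj (sesq {..<d} (entries X) v v)"
    by (simp add: sesq_adjoint)
  from arg_cong[OF this, of Im] show ?thesis by simp
qed

lemma psd_herm:
  assumes "psd d X"
  shows "herm d X"
proof -
  have pos: "pos_form {..<d} (entries X)" and X: "X \<in> carrier_mat d d"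
    using assms by (auto simp: psd_iff_pos_form)
  have "X $$ (s, r) = cnj (X $$ (r, s))" if "r < d" "s < d" for r s
    using pos_form_hermitian[OF pos, of "\<lambda>k. if k = s then 1 else 0" "\<lambda>k. if k = r then 1 else 0"]
      sesq_unit[of "{..<d}" s r "entries X"] sesq_unit[of "{..<d}" r s "entries X"] that
    by simp
  then show ?thesis using X unfolding herm_def by blast
qed

lemma herm_partial_transpose:
  assumes "herm (dA * dB) X"
  shows "herm (dA * dB) (partial_transpose p dA dB X)"
  unfolding herm_def
proof (intro conjI allI impI)
  fix r s assume rs: "r < dA * dB" "s < dA * dB"
  obtain r' s' where q: "pt_index p dB (r, s) = (r', s')" by (cases "pt_index p dB (r, s)")
  then have "r' < dA * dB" "s' < dA * dB" using pt_index_range[OF rs, of p] by auto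
  then show "partial_transpose p dA dB X $$ (s, r) = cnj (partial_transpose p dA dB X $$ (r, s))"
    using herm_entry[OF assms, of r' s'] rs q pt_index_swap[of p dB s r]
    by (simp add: partial_transpose_entry)
qed simp

lemma psd_add:
  assumes "psd d X" "psd d Y"
  shows "psd d (X + Y)"
proof -
  have "sesq {..<d} (entries (X + Y)) v v
      = sesq {..<d} (\<lambda>i j. X $$ (i, j) + Y $$ (i, j)) v v" for v
    using psd_carrier[OF assms(1)] psd_carrier[OF assms(2)] by (intro sesq_cong) auto
  then show ?thesis using assms by (simp add: psd_iff_pos_form pos_form_def sesq_add_op)
qed

lemma psd_smult:
  assumes "psd d X" "0 \<le> c"
  shows "psd d (complex_of_real c \<cdot>\<^sub>m X)"
proof -
  have "sesq {..<d} (entries (complex_of_real c \<cdot>\<^sub>m X)) v v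
      = sesq {..<d} (\<lambda>i j. complex_of_real c * X $$ (i, j)) v v" for v
    using psd_carrier[OF assms(1)] by (intro sesq_cong) auto
  moreover have "0 \<le> complex_of_real c" using assms(2) by (simp add: less_eq_complex_def)
  ultimately show ?thesis
    using assms by (auto simp: psd_iff_pos_form pos_form_def sesq_scale_op intro!: mult_nonneg_nonneg)
qed

lemma sesq_one: "sesq {..<d} (entries (1\<^sub>m d)) v v = complex_of_real ((nrm {..<d} v)\<^sup>2)"
  unfolding sesq_id[OF finite_lessThan, symmetric] by (rule sesq_cong) simp

lemma psd_one: "psd d (1\<^sub>m d)"
  by (simp add: psd_iff_pos_form pos_form_def sesq_one less_eq_complex_def del: of_real_power)

lemma psd_zero: "psd d (0\<^sub>m d d)"
  by (simp add: psd_iff_pos_form pos_form_def sesq_def)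

lemma mat_trace_one: "mat_trace (1\<^sub>m d) = of_nat d"
  by (simp add: mat_trace_def)

text \<open>The sum of the moduli of the entries dominates the operator norm, so the shift outweighs
  every negative value of the form.\<close>

lemma herm_shift_psd:
  assumes X: "herm d X"
  shows "psd d (X + complex_of_real (\<Sum>i<d. \<Sum>j<d. cmod (X $$ (i, j))) \<cdot>\<^sub>m 1\<^sub>m d)" (is "psd d (X + of_real ?t \<cdot>\<^sub>m _)")
  unfolding psd_iff_pos_form pos_form_def
proof (intro conjI allI)
  have car: "X \<in> carrier_mat d d" using X by (rule herm_carrier)
  then show "X + of_real ?t \<cdot>\<^sub>m 1\<^sub>m d \<in> carrier_mat d d" by simp
  fix v
  have "sesq {..<d} (entries (X + of_real ?t \<cdot>\<^sub>m 1\<^sub>m d)) v v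
      = sesq {..<d} (\<lambda>i j. X $$ (i, j) + of_real ?t * 1\<^sub>m d $$ (i, j)) v v"
    using car by (intro sesq_cong) auto
  also have "\<dots> = sesq {..<d} (entries X) v v + of_real (?t * (nrm {..<d} v)\<^sup>2)"
    unfolding sesq_add_op sesq_scale_op sesq_one by simp
  finally have eq: "sesq {..<d} (entries (X + of_real ?t \<cdot>\<^sub>m 1\<^sub>m d)) v v = \<dots>" .
  have "cmod (sesq {..<d} (entries X) v v) \<le> ?t * (nrm {..<d} v * nrm {..<d} v)"
    using op_bound_sum_entries[of "{..<d}" "entries X"] by (simp add: op_bound_def)
  then have "- Re (sesq {..<d} (entries X) v v) \<le> ?t * (nrm {..<d} v)\<^sup>2"
    unfolding power2_eq_square by (smt (verit) abs_Re_le_cmod)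
  then show "0 \<le> sesq {..<d} (entries (X + of_real ?t \<cdot>\<^sub>m 1\<^sub>m d)) v v"
    unfolding eq using herm_sesq_real[OF X, of v] by (simp add: less_eq_complex_def del: of_real_mult of_real_sum)
qed

text \<open>Every Hermitian matrix is a real combination of states, since it becomes positive after
  adding a multiple of the identity.\<close>

lemma linear_vanishing_on_states:
  fixes f :: "complex mat \<Rightarrow> complex"
  assumes add: "\<And>X Y. X \<in> carrier_mat d d \<Longrightarrow> Y \<in> carrier_mat d d \<Longrightarrow> f (X + Y) = f X + f Y"
    and smult: "\<And>c X. X \<in> carrier_mat d d \<Longrightarrow> f (c \<cdot>\<^sub>m X) = c * f X"
    and states: "\<And>\<rho>. state d \<rho> \<Longrightarrow> f \<rho> = 0"
    and "0 < d" and X: "herm d X"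
  shows "f X = 0"
proof -
  have pos: "f Y = 0" if Y: "psd d Y" and tr: "0 < Re (mat_trace Y)" for Y
  proof -
    define t where "t = Re (mat_trace Y)"
    have t: "mat_trace Y = of_real t"
      using psd_trace_nonneg[OF Y] by (simp add: t_def less_eq_complex_def complex_eq_iff)
    have "state d (of_real (1 / t) \<cdot>\<^sub>m Y)"
      unfolding state_def using psd_smult[OF Y, of "1 / t"] mat_trace_smult[OF psd_carrier[OF Y]] t tr
      by (simp add: t_def[symmetric])
    then have "of_real (1 / t) * f Y = 0" using states smult[OF psd_carrier[OF Y]] by metis
    then show ?thesis using tr by (simp add: t_def)
  qed
  have one: "f (1\<^sub>m d) = 0"
    using \<open>0 < d\<close> by (intro pos psd_one) (simp add: mat_trace_one)
  have psd0: "f Y = 0" if Y: "psd d Y" for Y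
  proof -
    \<comment> \<open>Adding the identity ensures a positive trace, which normalization to a state
      requires; this covers matrices of trace 0 as well.\<close>
    have "f (Y + 1\<^sub>m d) = 0"
    proof (rule pos)
      show "psd d (Y + 1\<^sub>m d)" using Y psd_one by (rule psd_add)
      show "0 < Re (mat_trace (Y + 1\<^sub>m d))"
        using psd_trace_nonneg[OF Y] \<open>0 < d\<close> psd_carrier[OF Y]
        by (simp add: mat_trace_add[of _ d] mat_trace_one less_eq_complex_def)
    qed
    then show ?thesis using one add[of Y "1\<^sub>m d"] psd_carrier[OF Y] by simp
  qed
  have car: "X \<in> carrier_mat d d" using X by (rule herm_carrier)
  show ?thesis
    using psd0[OF herm_shift_psd[OF X]] one add[OF car] smult[of "1\<^sub>m d"]
    by (simp del: of_real_sum)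
qed

lemma tr_prod_scale_left: "tr_prod I (\<lambda>i j. c * X i j) U = c * tr_prod I X U"
  by (simp add: tr_prod_def sum_distrib_left mult_ac)

lemma tr_prod_sum_left: "tr_prod I (\<lambda>i j. \<Sum>k\<in>K. X k i j) U = (\<Sum>k\<in>K. tr_prod I (X k) U)"
  by (simp add: tr_prod_def sum_distrib_right sum.swap[of _ _ K])

lemma tr_prod_sum_right: "tr_prod I X (\<lambda>i j. \<Sum>k\<in>K. U k i j) = (\<Sum>k\<in>K. tr_prod I X (U k))"
  by (simp add: tr_prod_def sum_distrib_left sum.swap[of _ _ K])

lemma tr_prod_cong:
  "(\<And>i j. i \<in> I \<Longrightarrow> j \<in> I \<Longrightarrow> X i j = Y i j) \<Longrightarrow> (\<And>i j. i \<in> I \<Longrightarrow> j \<in> I \<Longrightarrow> U i j = V i j) \<Longrightarrow>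
    tr_prod I X U = tr_prod I Y V"
  by (simp add: tr_prod_def)

text \<open>Both sides are linear and agree on states. Hermitian inputs are general enough, since
  partial transposes of positive matrices are Hermitian.\<close>

lemma locc_protocol_eq_trace:
  assumes P: "locc_protocol n dA dB P" and M: "M \<in> carrier_mat (dA * dB) (dA * dB)"
    and eq: "\<And>\<rho>. state (dA * dB) \<rho> \<Longrightarrow> P i \<rho> = mat_trace (\<rho> * M)"
    and "0 < dA * dB" and X: "herm (dA * dB) X"
  shows "P i X = mat_trace (X * M)"
proof -
  let ?d = "dA * dB"
  have "P i X - mat_trace (X * M) = 0"
  proof (rule linear_vanishing_on_states[where d = ?d and f = "\<lambda>X. P i X - mat_trace (X * M)"])
    fix X Y :: "complex mat" assume XY: "X \<in> carrier_mat ?d ?d" "Y \<in> carrier_mat ?d ?d"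
    then have "mat_trace ((X + Y) * M) = mat_trace (X * M) + mat_trace (Y * M)"
      using M by (simp add: add_mult_distrib_mat[OF XY M] mat_trace_add[of _ ?d])
    then show "P i (X + Y) - mat_trace ((X + Y) * M)
        = P i X - mat_trace (X * M) + (P i Y - mat_trace (Y * M))"
      using locc_protocol_add[OF P XY] by simp
  next
    fix c and X :: "complex mat" assume X: "X \<in> carrier_mat ?d ?d"
    then have "mat_trace ((c \<cdot>\<^sub>m X) * M) = c * mat_trace (X * M)"
      using M by (simp add: mult_smult_assoc_mat[OF X M] mat_trace_smult[of _ ?d])
    then show "P i (c \<cdot>\<^sub>m X) - mat_trace (c \<cdot>\<^sub>m X * M) = c * (P i X - mat_trace (X * M))"
      using locc_protocol_smult[OF P X] by (simp add: algebra_simps)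
  qed (use assms in auto)
  then show ?thesis by simp
qed

text \<open>The form of the transposed effect at \<open>v\<close> is the trace of that effect with
  the rank-one operator of \<open>v\<close>. Moving the transposition to the rank-one operator gives
  the protocol's value on an input whose partial transpose is positive.\<close>

lemma locc_measurement_pt_psd:
  assumes M: "locc_measurement n dA dB M" and i: "i < n" and "0 < dA * dB"
  shows "psd (dA * dB) (partial_transpose p dA dB (M i))"
  unfolding psd_iff_pos_form pos_form_def
proof (intro conjI allI)
  let ?d = "dA * dB" and ?T = "partial_transpose p dA dB"
  fix v
  obtain P where P: "locc_protocol n dA dB P"
    and eq: "\<And>\<rho>. state ?d \<rho> \<Longrightarrow> P i \<rho> = mat_trace (\<rho> * M i)"
    using M i by (auto simp: locc_measurement_def)
  have Mi: "M i \<in> carrier_mat ?d ?d"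
    using M i by (auto simp: locc_measurement_def measurement_def dest: psd_carrier)
  define V where "V = mat ?d ?d (\<lambda>(i, j). v i * cnj (v j))"
  have V: "V \<in> carrier_mat ?d ?d" by (simp add: V_def)
  have "sesq {..<?d} (entries V) w w = (\<Sum>i<?d. cnj (w i) * v i) * cnj (\<Sum>i<?d. cnj (w i) * v i)" for w
    by (simp add: sesq_def V_def sum_product mult_ac)
  then have "sesq {..<?d} (entries V) w w = of_real ((cmod (\<Sum>i<?d. cnj (w i) * v i))\<^sup>2)" for w
    by (simp only: complex_norm_square)
  then have psdV: "psd ?d V"
    using V by (simp add: psd_iff_pos_form pos_form_def less_eq_complex_def del: of_real_power)
  have TTV: "?T (?T V) = V" using V by (rule partial_transpose_involution)
  have "sesq {..<?d} (entries (?T (M i))) v v = tr_prod {..<?d} (entries V) (entries (?T (M i)))"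
    unfolding sesq_def tr_prod_def by (subst sum.swap) (simp add: V_def mult_ac)
  also have "\<dots> = tr_prod {..<?d} (entries (?T V)) (entries (M i))"
    using tr_prod_partial_transpose[of dA dB p "?T V" "M i"] TTV by simp
  also have "\<dots> = mat_trace (?T V * M i)"
    using Mi by (simp add: mat_trace_mult[of _ ?d])
  also have "\<dots> = P i (?T V)"
    using locc_protocol_eq_trace[OF P Mi eq \<open>0 < ?d\<close>] herm_partial_transpose[OF psd_herm[OF psdV]]
    by simp
  finally show "0 \<le> sesq {..<?d} (entries (?T (M i))) v v"
    using locc_protocol_pt_nonneg[OF P, of "?T V" p i] psdV TTV by simp
qed simp

lemma measurement_sum_entries:
  assumes "measurement n d M" "r < d" "s < d"
  shows "(\<Sum>i<n. M i $$ (r, s)) = (if r = s then 1 else 0)"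
proof -
  have "mat d d (\<lambda>rs. \<Sum>i<n. M i $$ rs) $$ (r, s) = 1\<^sub>m d $$ (r, s)"
    using assms(1) by (simp add: measurement_def)
  then show ?thesis using assms(2,3) by simp
qed

text \<open>Each effect is dominated by the sum of all effects, the identity.\<close>

lemma measurement_op_bound:
  assumes M: "measurement n d M" and i: "i < n"
  shows "op_bound {..<d} (entries (M i)) 1"
proof (rule pos_form_op_bound)
  have pos: "pos_form {..<d} (entries (M k))" if "k < n" for k
    using M that by (simp add: measurement_def psd_iff_pos_form)
  show "pos_form {..<d} (entries (M i))" using i by (rule pos)
  fix v
  have "Re (sesq {..<d} (entries (M i)) v v) \<le> (\<Sum>k<n. Re (sesq {..<d} (entries (M k)) v v))"
    using i pos by (intro member_le_sum) (auto simp: pos_form_def less_eq_complex_def)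
  also have "\<dots> = Re (sesq {..<d} (\<lambda>i j. \<Sum>k<n. M k $$ (i, j)) v v)"
    by (simp add: sesq_sum_op)
  also have "sesq {..<d} (\<lambda>i j. \<Sum>k<n. M k $$ (i, j)) v v
      = sesq {..<d} (\<lambda>i j. if i = j then 1 else 0) v v"
    using measurement_sum_entries[OF M] by (intro sesq_cong) auto
  finally show "Re (sesq {..<d} (entries (M i)) v v) \<le> (nrm {..<d} v)\<^sup>2"
    by (simp add: sesq_id del: of_real_power)
qed simp

lemma locc_measurement_pt_measurement:
  assumes M: "locc_measurement n dA dB M" and "0 < dA * dB"
  shows "measurement n (dA * dB) (\<lambda>i. partial_transpose p dA dB (M i))"
  unfolding measurement_def
proof (intro conjI allI impI)
  show "psd (dA * dB) (partial_transpose p dA dB (M i))" if "i < n" for i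
    using locc_measurement_pt_psd[OF M that \<open>0 < dA * dB\<close>] .
  show "mat (dA * dB) (dA * dB) (\<lambda>rs. \<Sum>i<n. partial_transpose p dA dB (M i) $$ rs) = 1\<^sub>m (dA * dB)"
  proof (rule eq_matI)
    fix r s assume "r < dim_row (1\<^sub>m (dA * dB) :: complex mat)" "s < dim_col (1\<^sub>m (dA * dB) :: complex mat)"
    then have rs: "r < dA * dB" "s < dA * dB" by simp_all
    obtain r' s' where q: "pt_index p dB (r, s) = (r', s')" by (cases "pt_index p dB (r, s)")
    then have lt: "r' < dA * dB" "s' < dA * dB" using pt_index_range[OF rs, of p] by auto
    \<comment> \<open>Partial transposition fixes the diagonal index pairs and, as an involution,
      maps no other pair onto the diagonal; hence it fixes the identity.\<close>
    have "r' = s' \<longleftrightarrow> r = s"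
    proof -
      have "pt_index p dB (r', s') = (r, s)" using pt_index_involution[OF rs, of p] q by simp
      moreover have "pt_index p dB (x, x) = (x, x)" for x by (cases p) (simp_all add: pt_index_def)
      ultimately show ?thesis using q by auto
    qed
    moreover have "(\<Sum>i<n. M i $$ (r', s')) = (if r' = s' then 1 else 0)"
      using M lt by (intro measurement_sum_entries) (auto simp: locc_measurement_def)
    ultimately show "mat (dA * dB) (dA * dB) (\<lambda>rs. \<Sum>i<n. partial_transpose p dA dB (M i) $$ rs) $$ (r, s)
        = 1\<^sub>m (dA * dB) $$ (r, s)"
      using rs q by (simp add: partial_transpose_entry)
  qed simp_all
qed

text \<open>A constant announcement shows that the set defining \<open>p_L\<close> is nonempty, so
  that its supremum is meaningful.\<close>

lemma announce_locc_measurement: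
  assumes "k < n"
  shows "locc_measurement n dA dB (\<lambda>i. if i = k then 1\<^sub>m (dA * dB) else 0\<^sub>m (dA * dB) (dA * dB))"
proof -
  let ?d = "dA * dB"
  let ?M = "\<lambda>i. if i = k then 1\<^sub>m ?d else 0\<^sub>m ?d ?d :: complex mat"
  have "(\<Sum>i<n. ?M i $$ (r, s)) = 1\<^sub>m ?d $$ (r, s)" if "r < ?d" "s < ?d" for r s
  proof -
    have "(\<Sum>i<n. ?M i $$ (r, s)) = (\<Sum>i<n. if i = k then 1\<^sub>m ?d $$ (r, s) else 0)"
      using that by (intro sum.cong refl) simp
    then show ?thesis using assms by simp
  qed
  then have "measurement n ?d ?M"
    by (auto simp: measurement_def psd_one psd_zero intro!: eq_matI)
  moreover have "(if i = k then mat_trace \<rho> else 0) = mat_trace (\<rho> * ?M i)" if "state ?d \<rho>" for \<rho> i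
  proof -
    have "\<rho> \<in> carrier_mat ?d ?d" using that by (auto simp: state_def dest: psd_carrier)
    then show ?thesis by (simp add: right_mult_zero_mat) (simp add: mat_trace_def)
  qed
  ultimately show ?thesis
    unfolding locc_measurement_def using locc_protocol.announce[OF assms, of dA dB] by blast
qed

section \<open>Tensor products and Fourier transform\<close>

text \<open>Identifies the regrouped tensor product with the plain one on pairs of indices, where
  the trace bound for products is available.\<close>

lemma bip_index_bij:
  "bij_betw (bip_index b1 a2 b2) {..<a1 * a2 * (b1 * b2)} ({..<a1 * b1} \<times> {..<a2 * b2})"
proof (rule bij_betw_byWitness[where f' = "\<lambda>(x, y).
    ((x div b1) * a2 + y div b2) * (b1 * b2) + ((x mod b1) * b2 + y mod b2)"])
  let ?g = "\<lambda>(x, y). ((x div b1) * a2 + y div b2) * (b1 * b2) + ((x mod b1) * b2 + y mod b2)"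
  have 1: "?g (bip_index b1 a2 b2 r) = r" "bip_index b1 a2 b2 r \<in> {..<a1 * b1} \<times> {..<a2 * b2}"
    if r: "r < a1 * a2 * (b1 * b2)" for r
  proof -
    define a b where "a = r div (b1 * b2)" and "b = r mod (b1 * b2)"
    have a: "a < a1 * a2" unfolding a_def by (rule div_less_factor[OF r])
    have b: "b < b1 * b2" using factor_pos[OF r] by (simp add: b_def)
    have lt: "a div a2 < a1" "a mod a2 < a2" "b div b2 < b1" "b mod b2 < b2"
      using factor_pos[OF a] factor_pos[OF b] by (auto intro: div_less_factor a b)
    have ab: "a * (b1 * b2) + b = r" unfolding a_def b_def by (rule div_mult_mod_eq)
    have eq: "bip_index b1 a2 b2 r = ((a div a2) * b1 + b div b2, (a mod a2) * b2 + b mod b2)"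
      by (simp add: bip_index_def Let_def a_def b_def)
    show "?g (bip_index b1 a2 b2 r) = r" using lt ab by (simp add: eq)
    show "bip_index b1 a2 b2 r \<in> {..<a1 * b1} \<times> {..<a2 * b2}"
      using lt by (simp add: eq pair_index_less)
  qed
  show "\<forall>r\<in>{..<a1 * a2 * (b1 * b2)}. ?g (bip_index b1 a2 b2 r) = r"
    using 1(1) by blast
  show "bip_index b1 a2 b2 ` {..<a1 * a2 * (b1 * b2)} \<subseteq> {..<a1 * b1} \<times> {..<a2 * b2}"
    using 1(2) by blast
  have 2: "bip_index b1 a2 b2 (?g (x, y)) = (x, y)" "?g (x, y) < a1 * a2 * (b1 * b2)"
    if x: "x < a1 * b1" and y: "y < a2 * b2" for x y
  proof -
    have lt: "x div b1 < a1" "x mod b1 < b1" "y div b2 < a2" "y mod b2 < b2"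
      using factor_pos[OF x] factor_pos[OF y] by (auto intro: div_less_factor x y)
    have lt2: "(x mod b1) * b2 + y mod b2 < b1 * b2"
      using lt by (simp add: pair_index_less)
    show "bip_index b1 a2 b2 (?g (x, y)) = (x, y)"
      using lt lt2 by (simp add: bip_index_def Let_def)
    show "?g (x, y) < a1 * a2 * (b1 * b2)"
      using lt lt2 by (auto intro!: pair_index_less)
  qed
  show "\<forall>q\<in>{..<a1 * b1} \<times> {..<a2 * b2}. bip_index b1 a2 b2 (?g q) = q"
    using 2(1) by auto
  show "?g ` ({..<a1 * b1} \<times> {..<a2 * b2}) \<subseteq> {..<a1 * a2 * (b1 * b2)}"
    using 2(2) by auto
qed

lemma partial_transpose_bip_tensor:
  "partial_transpose p (a1 * a2) (b1 * b2) (bip_tensor a1 b1 a2 b2 X Y)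
    = bip_tensor a1 b1 a2 b2 (partial_transpose p a1 b1 X) (partial_transpose p a2 b2 Y)"
  (is "?L = ?R")
proof (rule eq_matI)
  fix r s assume "r < dim_row ?R" "s < dim_col ?R"
  then have rs: "r < a1 * a2 * (b1 * b2)" "s < a1 * a2 * (b1 * b2)"
    by (simp_all add: bip_tensor_def)
  obtain r' s' where q: "pt_index p (b1 * b2) (r, s) = (r', s')"
    by (cases "pt_index p (b1 * b2) (r, s)")
  have rs': "r' < a1 * a2 * (b1 * b2)" "s' < a1 * a2 * (b1 * b2)"
    using pt_index_range[OF rs, of p] q by auto
  let ?h = "bip_index b1 a2 b2"
  have mem: "?h x \<in> {..<a1 * b1} \<times> {..<a2 * b2}" if "x < a1 * a2 * (b1 * b2)" for x
    using bip_index_bij[of b1 a2 b2 a1] that by (auto simp: bij_betw_def)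
  have lt: "fst (?h r) < a1 * b1" "fst (?h s) < a1 * b1" "snd (?h r) < a2 * b2" "snd (?h s) < a2 * b2"
    using mem[OF rs(1)] mem[OF rs(2)] by (auto simp: mem_Times_iff)
  have m: "r mod (b1 * b2) < b1 * b2" "s mod (b1 * b2) < b1 * b2"
    using factor_pos[OF rs(1)] by auto
  have b: "r mod (b1 * b2) div b2 < b1" "s mod (b1 * b2) div b2 < b1" "0 < b2"
    using m factor_pos[OF m(1)] by (auto intro: div_less_factor)
  \<comment> \<open>Regrouping intertwines transposing a party's joint system with transposing its
    part of each factor.\<close>
  have h: "(fst (?h r'), fst (?h s')) = pt_index p b1 (fst (?h r), fst (?h s))"
    "(snd (?h r'), snd (?h s')) = pt_index p b2 (snd (?h r), snd (?h s))"
    using q m b by (cases p; auto simp: pt_index_def bip_index_def Let_def)+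
  have "?L $$ (r, s) = bip_tensor a1 b1 a2 b2 X Y $$ (r', s')"
    using rs q by (simp add: partial_transpose_entry)
  also have "\<dots> = X $$ (fst (?h r'), fst (?h s')) * Y $$ (snd (?h r'), snd (?h s'))"
    using rs' by (simp add: bip_tensor_def)
  also have "\<dots> = ?R $$ (r, s)"
    unfolding h using rs lt by (simp add: bip_tensor_def partial_transpose_entry)
  finally show "?L $$ (r, s) = ?R $$ (r, s)" .
qed (simp_all add: bip_tensor_def)

lemma partial_transpose_bip_tensor_list:
  "partial_transpose p (dA ^ length Xs) (dB ^ length Xs) (bip_tensor_list dA dB Xs)
    = bip_tensor_list dA dB (map (partial_transpose p dA dB) Xs)"
proof (induction Xs)
  case Nil
  show ?case by (cases p) (auto intro!: eq_matI)
next
  case (Cons X Xs)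
  then show ?case by (simp add: partial_transpose_bip_tensor)
qed

section \<open>Characters of the cyclic group and sums over words\<close>

definition unit_root :: "nat \<Rightarrow> nat \<Rightarrow> complex" where
  "unit_root n m = cis (2 * pi * real m / real n)"

lemma unit_root_0 [simp]: "unit_root n 0 = 1"
  by (simp add: unit_root_def)

lemma cmod_unit_root [simp]: "cmod (unit_root n m) = 1"
  by (simp add: unit_root_def)

lemma unit_root_add: "unit_root n (a + b) = unit_root n a * unit_root n b"
  by (simp add: unit_root_def cis_mult algebra_simps add_divide_distrib)

lemma unit_root_mult: "unit_root n (k * a) = unit_root n a ^ k"
  by (simp add: unit_root_def DeMoivre algebra_simps)

lemma unit_root_power_order: "0 < n \<Longrightarrow> unit_root n m ^ n = 1"
  using cis_multiple_2pi[of "real m"] by (simp add: unit_root_def DeMoivre)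

lemma unit_root_mod: "0 < n \<Longrightarrow> unit_root n (m mod n) = unit_root n m"
proof -
  assume n: "0 < n"
  have "unit_root n (n * (m div n) + m mod n) = unit_root n (m mod n)"
    by (simp only: unit_root_add unit_root_mult unit_root_power_order[OF n] mult_1)
  then show ?thesis by simp
qed

lemma unit_root_eq_iff:
  assumes n: "0 < n"
  shows "unit_root n a = unit_root n b \<longleftrightarrow> a mod n = b mod n"
proof
  assume "unit_root n a = unit_root n b"
  then have "unit_root n (a mod n) = unit_root n (b mod n)" by (simp add: unit_root_mod[OF n])
  moreover have "inj_on (unit_root n) {..<n}"
    using bij_betw_roots_unity[OF n] by (simp add: bij_betw_def unit_root_def[abs_def])
  ultimately show "a mod n = b mod n" using n by (auto dest: inj_onD)
qed (metis unit_root_mod[OF n])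

text \<open>A geometric sum in \<open>z\<close>, which is an n-th root of unity and equals 1 exactly
  when \<open>a\<close> and \<open>b\<close> are congruent.\<close>

lemma unit_root_orthogonality:
  assumes n: "0 < n"
  shows "(\<Sum>k<n. cnj (unit_root n (k * b)) * unit_root n (k * a)) = (if a mod n = b mod n then of_nat n else 0)"
proof -
  define z where "z = cnj (unit_root n b) * unit_root n a"
  have "(\<Sum>k<n. cnj (unit_root n (k * b)) * unit_root n (k * a)) = (\<Sum>k<n. z ^ k)"
    by (simp add: z_def unit_root_mult power_mult_distrib)
  moreover have bb: "cnj (unit_root n b) * unit_root n b = 1"
    by (metis cmod_unit_root complex_norm_square mult.commute of_real_1 power_one)
  have "z = 1 \<longleftrightarrow> unit_root n a = unit_root n b"
    unfolding z_def by (metis bb mult.assoc mult.commute mult_1)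
  moreover have "z ^ n = 1"
    using unit_root_power_order[OF n] by (simp add: z_def power_mult_distrib flip: complex_cnj_power)
  ultimately show ?thesis
    using unit_root_eq_iff[OF n, of a b] by (auto simp: geometric_sum)
qed

definition all_words :: "nat \<Rightarrow> nat \<Rightarrow> nat list set" where
  "all_words n L = {c. set c \<subseteq> {..<n} \<and> length c = L}"

lemma finite_all_words: "finite (all_words n L)"
  unfolding all_words_def by (rule finite_lists_length_eq) simp

lemma sum_all_words_Suc:
  "(\<Sum>c\<in>all_words n (Suc L). f c) = (\<Sum>i<n. \<Sum>c\<in>all_words n L. f (i # c))"
proof -
  have "all_words n (Suc L) = (\<lambda>(i, c). i # c) ` ({..<n} \<times> all_words n L)"
    by (auto simp: all_words_def length_Suc_conv image_iff)
  moreover have "inj_on (\<lambda>(i, c). i # c) ({..<n} \<times> all_words n L)"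
    by (auto simp: inj_on_def)
  ultimately show ?thesis by (simp add: sum.reindex sum.cartesian_product case_prod_unfold)
qed

text \<open>Orthogonality of the characters selects the residue \<open>i\<close>. What remains are
  sums over all words, which factor letter by letter.\<close>

lemma sum_words_fourier:
  assumes n: "0 < n" and i: "i < n"
  shows "(\<Sum>c\<in>words n L i. f c)
    = (1 / of_nat n) * (\<Sum>k<n. cnj (unit_root n (k * i)) * (\<Sum>c\<in>all_words n L. unit_root n (k * sum_list c) * f c))"
proof -
  have "(\<Sum>k<n. cnj (unit_root n (k * i)) * (\<Sum>c\<in>all_words n L. unit_root n (k * sum_list c) * f c))
      = (\<Sum>c\<in>all_words n L. (\<Sum>k<n. cnj (unit_root n (k * i)) * unit_root n (k * sum_list c)) * f c)"
    by (simp add: sum_distrib_left sum_distrib_right mult.assoc sum.swap[of _ _ "{..<n}"])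
  also have "\<dots> = (\<Sum>c\<in>all_words n L. if sum_list c mod n = i then of_nat n * f c else 0)"
    using i by (intro sum.cong refl) (simp add: unit_root_orthogonality[OF n])
  also have "\<dots> = (\<Sum>c\<in>words n L i. of_nat n * f c)"
    by (subst sum.inter_filter[OF finite_all_words, symmetric])
      (intro sum.cong, auto simp: words_def all_words_def)
  finally show ?thesis using n by (simp add: sum_distrib_left)
qed

lemma finite_words: "finite (words n L i)"
  by (rule finite_subset[OF _ finite_all_words[of n L]]) (auto simp: words_def all_words_def)

section \<open>Tensor powers of the Fourier components\<close>

definition fourier_op :: "nat \<Rightarrow> (nat \<Rightarrow> real) \<Rightarrow> (nat \<Rightarrow> complex mat) \<Rightarrow> nat \<Rightarrow> nat \<Rightarrow> nat \<Rightarrow> complex" where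
  "fourier_op n \<eta> R k r s = (\<Sum>i<n. unit_root n (k * i) * (of_real (\<eta> i) * R i $$ (r, s)))"

definition fourier_power ::
  "nat \<Rightarrow> nat \<Rightarrow> nat \<Rightarrow> (nat \<Rightarrow> real) \<Rightarrow> (nat \<Rightarrow> complex mat) \<Rightarrow> nat \<Rightarrow> nat \<Rightarrow> nat \<Rightarrow> nat \<Rightarrow> complex" where
  "fourier_power n dA dB \<eta> R L k r s = (\<Sum>c\<in>all_words n L. unit_root n (k * sum_list c) *
     (of_real (prod_list (map \<eta> c)) * bip_tensor_list dA dB (map R c) $$ (r, s)))"

text \<open>Character, prior and tensor product are all multiplicative when a letter is prepended,
  so the sum over words splits; iterated, this makes \<open>fourier_power\<close> a tensor power of
  \<open>fourier_op\<close>.\<close>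

lemma fourier_power_Suc:
  assumes "r < dA ^ Suc L * dB ^ Suc L" "s < dA ^ Suc L * dB ^ Suc L"
  defines "h \<equiv> bip_index dB (dA ^ L) (dB ^ L)"
  shows "fourier_power n dA dB \<eta> R (Suc L) k r s
    = fourier_op n \<eta> R k (fst (h r)) (fst (h s)) * fourier_power n dA dB \<eta> R L k (snd (h r)) (snd (h s))"
proof -
  have "bip_tensor_list dA dB (map R (i # c)) $$ (r, s)
      = R i $$ (fst (h r), fst (h s)) * bip_tensor_list dA dB (map R c) $$ (snd (h r), snd (h s))"
    if "c \<in> all_words n L" for i c
    using assms(1,2) that by (simp add: bip_tensor_def h_def all_words_def)
  then have "fourier_power n dA dB \<eta> R (Suc L) k r s = (\<Sum>i<n. \<Sum>c\<in>all_words n L.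
      (unit_root n (k * i) * (of_real (\<eta> i) * R i $$ (fst (h r), fst (h s)))) *
      (unit_root n (k * sum_list c) * (of_real (prod_list (map \<eta> c)) *
        bip_tensor_list dA dB (map R c) $$ (snd (h r), snd (h s)))))"
    unfolding fourier_power_def sum_all_words_Suc
    by (intro sum.cong refl) (simp add: unit_root_add distrib_left mult_ac)
  then show ?thesis by (simp add: fourier_op_def fourier_power_def sum_product)
qed

lemma fourier_power_trace_bound:
  assumes "trace_bound {..<dA * dB} (fourier_op n \<eta> R k) s" "0 \<le> s"
  shows "trace_bound {..<dA ^ L * dB ^ L} (fourier_power n dA dB \<eta> R L k) (s ^ L)"
proof (induction L)
  case 0
  \<comment> \<open>The empty tensor power is the scalar 1 on a one-dimensional space, with trace
    norm \<open>s ^ 0 = 1\<close> even for \<open>s = 0\<close>.\<close>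
  have "all_words n 0 = {[]}" by (auto simp: all_words_def)
  then have "fourier_power n dA dB \<eta> R 0 k 0 0 = 1" by (simp add: fourier_power_def)
  then show ?case
    using op_bound_entry[of "{..<Suc 0}" _ _ 0 0] by (auto simp: trace_bound_def tr_prod_def)
next
  case (Suc L)
  let ?h = "bip_index dB (dA ^ L) (dB ^ L)"
  have h: "bij_betw ?h {..<dA ^ Suc L * dB ^ Suc L} ({..<dA * dB} \<times> {..<dA ^ L * dB ^ L})"
    using bip_index_bij[of dB "dA ^ L" "dB ^ L" dA] by simp
  have "trace_bound {..<dA ^ Suc L * dB ^ Suc L} (fourier_power n dA dB \<eta> R (Suc L) k) (s * s ^ L)"
    by (rule trace_bound_cong[OF trace_bound_reindex[OF h trace_bound_times[OF assms(1) Suc]]])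
      (simp_all add: fourier_power_Suc case_prod_unfold assms(2) del: power_Suc)
  then show ?case by simp
qed

lemma fourier_power_trace:
  assumes "(\<Sum>r<dA * dB. fourier_op n \<eta> R k r r) = 1"
  shows "(\<Sum>r<dA ^ L * dB ^ L. fourier_power n dA dB \<eta> R L k r r) = 1"
proof (induction L)
  case 0
  have "all_words n 0 = {[]}" by (auto simp: all_words_def)
  then show ?case by (simp add: fourier_power_def)
next
  case (Suc L)
  let ?h = "bip_index dB (dA ^ L) (dB ^ L)"
  let ?f = "\<lambda>(i, j). fourier_op n \<eta> R k i i * fourier_power n dA dB \<eta> R L k j j"
  have h: "bij_betw ?h {..<dA ^ Suc L * dB ^ Suc L} ({..<dA * dB} \<times> {..<dA ^ L * dB ^ L})"
    using bip_index_bij[of dB "dA ^ L" "dB ^ L" dA] by simp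
  have "(\<Sum>r<dA ^ Suc L * dB ^ Suc L. fourier_power n dA dB \<eta> R (Suc L) k r r)
      = (\<Sum>r<dA ^ Suc L * dB ^ Suc L. ?f (?h r))"
    by (intro sum.cong refl) (simp add: fourier_power_Suc case_prod_unfold del: power_Suc)
  also have "\<dots> = (\<Sum>q\<in>{..<dA * dB} \<times> {..<dA ^ L * dB ^ L}. ?f q)"
    by (rule sum.reindex_bij_betw[OF h])
  also have "\<dots> = (\<Sum>r<dA * dB. fourier_op n \<eta> R k r r)
      * (\<Sum>r<dA ^ L * dB ^ L. fourier_power n dA dB \<eta> R L k r r)"
    unfolding sum.cartesian_product' sum_product by simp
  finally show ?case using Suc assms by simp
qed

section \<open>Success probabilities\<close>

lemma tr_prod_add_right:
  "tr_prod I X (\<lambda>i j. U i j + V i j) = tr_prod I X U + tr_prod I X V"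
  by (simp add: tr_prod_def algebra_simps sum.distrib)

lemma tr_prod_scale_right: "tr_prod I X (\<lambda>i j. c * U i j) = c * tr_prod I X U"
  by (simp add: tr_prod_def sum_distrib_left mult_ac)

lemma tr_prod_adjoint:
  "tr_prod I (\<lambda>i j. cnj (X j i)) (\<lambda>i j. cnj (U j i)) = cnj (tr_prod I X U)"
  unfolding tr_prod_def by (subst sum.swap) simp

lemma tr_prod_id:
  "finite I \<Longrightarrow> tr_prod I X (\<lambda>i j. if i = j then 1 else 0) = (\<Sum>i\<in>I. X i i)"
  by (simp add: tr_prod_def if_distrib cong: if_cong)

lemma measurement_carrier: "measurement n d M \<Longrightarrow> i < n \<Longrightarrow> M i \<in> carrier_mat d d"
  by (auto simp: measurement_def dest: psd_carrier)

text \<open>The content is boundedness of the set under the supremum: effects are contractions, and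
  their pairing with fixed operators is bounded uniformly.\<close>

lemma q_G_upper:
  assumes M: "measurement n (dA * dB) M" and \<eta>: "\<And>i. i < n \<Longrightarrow> 0 \<le> \<eta> i"
  shows "(\<Sum>i<n. \<eta> i * Re (mat_trace (partial_transpose p dA dB (\<rho> i) * M i))) \<le> q_G p n dA dB \<eta> \<rho>"
proof -
  let ?T = "\<lambda>i. partial_transpose p dA dB (\<rho> i)"
  let ?v = "\<lambda>M. \<Sum>i<n. \<eta> i * Re (mat_trace (?T i * M i))"
  let ?b = "\<lambda>i. \<Sum>r<dA * dB. \<Sum>s<dA * dB. cmod (?T i $$ (r, s))"
  have "?v M \<le> (\<Sum>i<n. \<eta> i * ?b i)" if M: "measurement n (dA * dB) M" for M
  proof (intro sum_mono mult_left_mono)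
    fix i assume "i \<in> {..<n}"
    then have i: "i < n" by simp
    have "Re (mat_trace (?T i * M i)) \<le> cmod (tr_prod {..<dA * dB} (entries (?T i)) (entries (M i)))"
      using mat_trace_mult[OF partial_transpose_carrier measurement_carrier[OF M i]]
      by (simp add: complex_Re_le_cmod)
    also have "\<dots> \<le> ?b i * 1"
      using trace_bound_sum_entries[of "{..<dA * dB}" "entries (?T i)"] measurement_op_bound[OF M i]
      unfolding trace_bound_def by blast
    finally show "Re (mat_trace (?T i * M i)) \<le> ?b i" by simp
    show "0 \<le> \<eta> i" using i by (rule \<eta>)
  qed
  then have "bdd_above {?v M | M. measurement n (dA * dB) M}"
    by (intro bdd_aboveI[of _ "\<Sum>i<n. \<eta> i * ?b i"]) blast
  then show ?thesis unfolding q_G_def using M by (intro cSup_upper) blast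
qed

text \<open>The measurement with elements \<open>(I + Re (\<omega>\<^sup>k\<^sup>i V)) / n\<close>, where \<open>Re\<close> is the Hermitian part,
  turns the pairing of the \<open>k\<close>-th Fourier component with a contraction \<open>V\<close> into a guessing
  probability.\<close>

lemma q_G_fourier_op:
  assumes ens: "ensemble n (dA * dB) \<eta> \<rho>" and k: "0 < k" "k < n"
    and V: "op_bound {..<dA * dB} V 1"
  shows "1 + Re (tr_prod {..<dA * dB} (fourier_op n \<eta> (\<lambda>i. partial_transpose p dA dB (\<rho> i)) k) V)
    \<le> n * q_G p n dA dB \<eta> \<rho>"
proof -
  let ?d = "dA * dB" and ?T = "\<lambda>i. partial_transpose p dA dB (\<rho> i)"
  let ?w = "\<lambda>i. unit_root n (k * i)"
  \<comment> \<open>\<open>V\<close> need not be Hermitian, so its rotated version is averaged with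
    the adjoint. In the quadratic form this leaves a real part, which a contraction cannot push
    below minus the squared norm.\<close>
  define F where "F i r s = (1 / of_nat n) * ((if r = s then 1 else 0)
      + (1 / 2) * (?w i * V r s + cnj (?w i * V s r)))" for i r s
  define M where "M i = mat ?d ?d (\<lambda>(r, s). F i r s)" for i
  have n: "0 < n" using k by simp
  have "psd ?d (M i)" for i
    unfolding psd_iff_pos_form pos_form_def
  proof (intro conjI allI)
    fix v
    let ?q = "?w i * sesq {..<?d} V v v"
    have "sesq {..<?d} (entries (M i)) v v = sesq {..<?d} (F i) v v"
      by (rule sesq_cong) (simp add: M_def)
    also have "\<dots> = (1 / of_nat n) * (of_real ((nrm {..<?d} v)\<^sup>2) + (1 / 2) * (?q + cnj ?q))"
      unfolding F_def sesq_scale_op sesq_add_op sesq_adjoint[of _ "\<lambda>r s. ?w i * V r s"]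
      by (simp add: sesq_id)
    also have "(1 / 2) * (?q + cnj ?q) = of_real (Re ?q)"
      unfolding complex_add_cnj by simp
    also have "(1 / of_nat n) * (of_real ((nrm {..<?d} v)\<^sup>2) + of_real (Re ?q))
        = complex_of_real ((1 / n) * ((nrm {..<?d} v)\<^sup>2 + Re ?q))"
      by (simp only: of_real_mult of_real_add of_real_divide of_real_1 of_real_of_nat_eq)
    finally have eq: "sesq {..<?d} (entries (M i)) v v = \<dots>" .
    have "cmod ?q \<le> (nrm {..<?d} v)\<^sup>2"
      using V by (simp add: op_bound_def norm_mult power2_eq_square)
    then have "0 \<le> (nrm {..<?d} v)\<^sup>2 + Re ?q"
      using abs_Re_le_cmod[of ?q] by linarith
    then have "0 \<le> (1 / n) * ((nrm {..<?d} v)\<^sup>2 + Re ?q)" by simp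
    then show "0 \<le> sesq {..<?d} (entries (M i)) v v"
      unfolding eq less_eq_complex_def by (metis Re_complex_of_real Im_complex_of_real zero_complex.sel)
  qed (simp add: M_def)
  moreover have "(\<Sum>i<n. M i $$ (r, s)) = 1\<^sub>m ?d $$ (r, s)" if "r < ?d" "s < ?d" for r s
  proof -
    \<comment> \<open>Here \<open>0 < k < n\<close> enters: the character is nontrivial, so its
      values cancel and the effects sum to the identity.\<close>
    have w0: "(\<Sum>i<n. ?w i) = 0"
      using unit_root_orthogonality[OF n, of 0 k] k by (simp add: mult.commute)
    have "(\<Sum>i<n. M i $$ (r, s)) = (1 / of_nat n) * (of_nat n * (if r = s then 1 else 0)
        + (1 / 2) * ((\<Sum>i<n. ?w i) * V r s + cnj ((\<Sum>i<n. ?w i) * V s r)))"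
      using that by (simp add: M_def F_def sum.distrib sum_distrib_left sum_distrib_right algebra_simps)
    then show ?thesis using w0 n that by simp
  qed
  ultimately have M: "measurement n ?d M"
    unfolding measurement_def by (auto intro!: eq_matI)
  have tr: "Re (mat_trace (?T i * M i)) = (1 / n) * (1 + Re (?w i * tr_prod {..<?d} (entries (?T i)) V))"
    if i: "i < n" for i
  proof -
    have st: "psd ?d (\<rho> i)" "mat_trace (\<rho> i) = 1"
      using ens i by (auto simp: ensemble_def state_def)
    \<comment> \<open>Partial transposition may destroy positivity but keeps Hermiticity, which is
      enough for the adjoint term to contribute the complex conjugate.\<close>
    have "herm ?d (?T i)" using herm_partial_transpose[OF psd_herm[OF st(1)]] .
    then have adj: "tr_prod {..<?d} (entries (?T i)) (\<lambda>r s. cnj (?w i * V s r))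
        = tr_prod {..<?d} (\<lambda>r s. cnj (?T i $$ (s, r))) (\<lambda>r s. cnj (?w i * V s r))"
      by (intro tr_prod_cong herm_entry refl) auto
    have "(\<Sum>r<?d. ?T i $$ (r, r)) = mat_trace (?T i)"
      by (simp add: mat_trace_def)
    then have one: "(\<Sum>r<?d. ?T i $$ (r, r)) = 1"
      using mat_trace_partial_transpose[OF psd_carrier[OF st(1)]] st(2) by simp
    have "mat_trace (?T i * M i) = tr_prod {..<?d} (entries (?T i)) (F i)"
      unfolding mat_trace_mult[OF partial_transpose_carrier measurement_carrier[OF M i]]
      by (rule tr_prod_cong) (simp_all add: M_def)
    also have "\<dots> = (1 / of_nat n) * (1 + (1 / 2) * (?w i * tr_prod {..<?d} (entries (?T i)) V
        + cnj (?w i * tr_prod {..<?d} (entries (?T i)) V)))"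
      unfolding F_def tr_prod_scale_right tr_prod_add_right tr_prod_id[OF finite_lessThan] one adj
        tr_prod_adjoint[of _ "entries (?T i)" "\<lambda>r s. ?w i * V r s"] ..
    also have "(1 / 2) * (?w i * tr_prod {..<?d} (entries (?T i)) V
        + cnj (?w i * tr_prod {..<?d} (entries (?T i)) V))
        = of_real (Re (?w i * tr_prod {..<?d} (entries (?T i)) V))"
      unfolding complex_add_cnj by simp
    also have "(1 / of_nat n) * (1 + of_real (Re (?w i * tr_prod {..<?d} (entries (?T i)) V)))
        = complex_of_real ((1 / n) * (1 + Re (?w i * tr_prod {..<?d} (entries (?T i)) V)))"
      by (simp only: of_real_mult of_real_add of_real_divide of_real_1 of_real_of_nat_eq)
    finally show ?thesis by (metis Re_complex_of_real)
  qed
  have "(\<Sum>i<n. \<eta> i * Re (mat_trace (?T i * M i)))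
      = (\<Sum>i<n. \<eta> i * ((1 / n) * (1 + Re (?w i * tr_prod {..<?d} (entries (?T i)) V))))"
    by (intro sum.cong refl) (simp add: tr)
  also have "\<dots> = (1 / n) * ((\<Sum>i<n. \<eta> i) + (\<Sum>i<n. \<eta> i * Re (?w i * tr_prod {..<?d} (entries (?T i)) V)))"
    by (simp only: sum_distrib_left distrib_left sum.distrib mult_1_right mult.left_commute[of "1 / n"])
      (simp add: mult_ac)
  also have "(\<Sum>i<n. \<eta> i * Re (?w i * tr_prod {..<?d} (entries (?T i)) V))
      = Re (tr_prod {..<?d} (fourier_op n \<eta> ?T k) V)"
    unfolding fourier_op_def tr_prod_sum_left tr_prod_scale_left by (simp add: algebra_simps)
  also have "(\<Sum>i<n. \<eta> i) = 1" using ens by (simp add: ensemble_def)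
  finally have "(1 / n) * (1 + Re (tr_prod {..<?d} (fourier_op n \<eta> ?T k) V)) \<le> q_G p n dA dB \<eta> \<rho>"
    using q_G_upper[OF M, of \<eta> p \<rho>] ens by (simp add: ensemble_def)
  then show ?thesis using n by (simp add: field_simps)
qed

text \<open>A phase on the contraction turns the bound on the real part into one on the modulus. The
  maximum with 0 keeps the bound nonnegative, as its powers require.\<close>

lemma fourier_op_trace_bound:
  assumes ens: "ensemble n (dA * dB) \<eta> \<rho>" and k: "0 < k" "k < n"
  shows "trace_bound {..<dA * dB} (fourier_op n \<eta> (\<lambda>i. partial_transpose p dA dB (\<rho> i)) k)
    (max 0 (n * q_G p n dA dB \<eta> \<rho> - 1))"
  (is "trace_bound ?I ?A ?s")
  unfolding trace_bound_def
proof (intro allI impI)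
  fix U c assume U: "op_bound ?I U c"
  then have c0: "0 \<le> c" by (simp add: op_bound_def)
  let ?t = "tr_prod ?I ?A U"
  show "cmod ?t \<le> ?s * c"
  proof (cases "c = 0 \<or> ?t = 0")
    case True
    moreover have "?t = 0" if "c = 0"
      using op_bound_entry[OF finite_lessThan U] that by (simp add: tr_prod_def)
    ultimately show ?thesis using c0 by auto
  next
    case False
    then have c: "0 < c" and t: "?t \<noteq> 0" using c0 by auto
    \<comment> \<open>The phase makes the pairing real and positive, and the modulus
      \<open>1 / c\<close> rescales \<open>U\<close> to a contraction.\<close>
    define z where "z = cnj ?t / of_real (cmod ?t * c)"
    have cz: "cmod z = 1 / c" using t c by (simp add: z_def norm_divide norm_mult)
    have "op_bound ?I (\<lambda>r s. z * U r s) 1"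
      using U c unfolding op_bound_def sesq_scale_op by (simp add: norm_mult cz field_simps)
    then have "1 + Re (tr_prod ?I ?A (\<lambda>r s. z * U r s)) \<le> n * q_G p n dA dB \<eta> \<rho>"
      by (rule q_G_fourier_op[OF ens k])
    moreover have "tr_prod ?I ?A (\<lambda>r s. z * U r s) = of_real (cmod ?t / c)"
    proof -
      have "?t * cnj ?t = of_real ((cmod ?t)\<^sup>2)" by (metis complex_norm_square)
      then have "z * ?t = of_real (cmod ?t / c)"
        using t c by (simp add: z_def field_simps power2_eq_square)
      then show ?thesis by (simp add: tr_prod_scale_right)
    qed
    ultimately have "cmod ?t / c \<le> ?s" by simp
    then show ?thesis using c by (simp add: field_simps)
  qed
qed

text \<open>Multiplying by the prior removes the arbitrary choice of states: if the prior is 0, all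
  its nonnegative summands vanish and so does the right-hand side.\<close>

lemma power_prior_state_entry:
  assumes \<eta>: "\<And>i. i < n \<Longrightarrow> 0 \<le> \<eta> i" and \<sigma>: "power_states n dA dB \<eta> \<rho> L \<sigma>" and i: "i < n"
    and rs: "r < dA ^ L * dB ^ L" "s < dA ^ L * dB ^ L"
  shows "of_real (power_prior n \<eta> L i) * \<sigma> i $$ (r, s) = (\<Sum>c\<in>words n L i.
    of_real (prod_list (map \<eta> c)) * bip_tensor_list dA dB (map \<rho> c) $$ (r, s))"
proof (cases "power_prior n \<eta> L i = 0")
  case True
  have "0 \<le> prod_list (map \<eta> c)" if "c \<in> words n L i" for c
    using that \<eta> by (intro prod_list_nonneg) (auto simp: words_def)
  then have "prod_list (map \<eta> c) = 0" if "c \<in> words n L i" for c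
    using True that unfolding power_prior_def by (simp add: sum_nonneg_eq_0_iff finite_words)
  then show ?thesis using True by simp
next
  case False
  then have "\<sigma> i = power_state n dA dB \<eta> \<rho> L i"
    using \<sigma> i by (auto simp: power_states_def)
  then show ?thesis using False rs by (simp add: power_state_def)
qed

lemma power_state_carrier:
  assumes "power_states n dA dB \<eta> \<rho> L \<sigma>" "i < n"
  shows "\<sigma> i \<in> carrier_mat (dA ^ L * dB ^ L) (dA ^ L * dB ^ L)"
proof (cases "power_prior n \<eta> L i = 0")
  case True
  then have "state (dA ^ L * dB ^ L) (\<sigma> i)" using assms by (auto simp: power_states_def)
  then show ?thesis by (auto simp: state_def dest: psd_carrier)
next
  case False
  then have "\<sigma> i = power_state n dA dB \<eta> \<rho> L i" using assms by (auto simp: power_states_def)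
  then show ?thesis by (simp add: power_state_def)
qed

text \<open>Transposing both factors leaves the trace unchanged, and transposition of the state
  passes through the tensor product to the single letters, where Fourier inversion applies.\<close>

lemma power_state_trace_fourier:
  fixes p :: party and dA dB :: nat and \<rho> :: "nat \<Rightarrow> complex mat"
  defines "R \<equiv> \<lambda>i. partial_transpose p dA dB (\<rho> i)"
  assumes \<eta>: "\<And>i. i < n \<Longrightarrow> 0 \<le> \<eta> i" and \<sigma>: "power_states n dA dB \<eta> \<rho> L \<sigma>" and i: "i < n"
    and M: "M \<in> carrier_mat (dA ^ L * dB ^ L) (dA ^ L * dB ^ L)"
  shows "of_real (power_prior n \<eta> L i) * mat_trace (\<sigma> i * M) = (1 / of_nat n) *
    (\<Sum>k<n. cnj (unit_root n (k * i)) * tr_prod {..<dA ^ L * dB ^ L}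
      (fourier_power n dA dB \<eta> R L k) (entries (partial_transpose p (dA ^ L) (dB ^ L) M)))"
proof -
  let ?d = "dA ^ L * dB ^ L" and ?T = "partial_transpose p (dA ^ L) (dB ^ L)"
  define B where "B = mat ?d ?d (\<lambda>rs. of_real (power_prior n \<eta> L i) * \<sigma> i $$ rs)"
  have n: "0 < n" using i by simp
  have entry: "?T B $$ (r, s) = (1 / of_nat n) *
      (\<Sum>k<n. cnj (unit_root n (k * i)) * fourier_power n dA dB \<eta> R L k r s)"
    if rs: "r < ?d" "s < ?d" for r s
  proof -
    obtain r' s' where q: "pt_index p (dB ^ L) (r, s) = (r', s')" by (cases "pt_index p (dB ^ L) (r, s)")
    then have lt: "r' < ?d" "s' < ?d" using pt_index_range[OF rs, of p] by auto
    have tens: "bip_tensor_list dA dB (map \<rho> c) $$ (r', s') = bip_tensor_list dA dB (map R c) $$ (r, s)"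
      if "c \<in> words n L i" for c
    proof -
      have "length c = L" using that by (simp add: words_def)
      then have "?T (bip_tensor_list dA dB (map \<rho> c)) = bip_tensor_list dA dB (map R c)"
        using partial_transpose_bip_tensor_list[of p dA "map \<rho> c" dB] by (simp add: R_def comp_def)
      then show ?thesis using partial_transpose_entry[OF rs, of p] q by metis
    qed
    have "?T B $$ (r, s) = of_real (power_prior n \<eta> L i) * \<sigma> i $$ (r', s')"
      using rs lt q by (simp add: partial_transpose_entry B_def)
    also have "\<dots> = (\<Sum>c\<in>words n L i.
        of_real (prod_list (map \<eta> c)) * bip_tensor_list dA dB (map \<rho> c) $$ (r', s'))"
      using \<eta> \<sigma> i lt by (rule power_prior_state_entry)
    also have "\<dots> = (\<Sum>c\<in>words n L i.
        of_real (prod_list (map \<eta> c)) * bip_tensor_list dA dB (map R c) $$ (r, s))"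
      by (intro sum.cong refl) (simp add: tens)
    finally show ?thesis unfolding sum_words_fourier[OF n i] fourier_power_def .
  qed
  have "of_real (power_prior n \<eta> L i) * mat_trace (\<sigma> i * M)
      = tr_prod {..<?d} (\<lambda>r s. of_real (power_prior n \<eta> L i) * \<sigma> i $$ (r, s)) (entries M)"
    using mat_trace_mult[OF power_state_carrier[OF \<sigma> i] M] by (simp add: tr_prod_scale_left)
  also have "\<dots> = tr_prod {..<?d} (entries B) (entries M)"
    by (rule tr_prod_cong) (simp_all add: B_def)
  also have "\<dots> = tr_prod {..<?d} (entries (?T B)) (entries (?T M))"
    by (rule tr_prod_partial_transpose[symmetric])
  also have "\<dots> = tr_prod {..<?d} (\<lambda>r s. (1 / of_nat n) *
      (\<Sum>k<n. cnj (unit_root n (k * i)) * fourier_power n dA dB \<eta> R L k r s)) (entries (?T M))"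
    by (rule tr_prod_cong) (simp_all add: entry)
  finally show ?thesis
    unfolding tr_prod_scale_left tr_prod_sum_left .
qed

lemma locc_value_bound:
  assumes ens: "ensemble n (dA * dB) \<eta> \<rho>" and \<sigma>: "power_states n dA dB \<eta> \<rho> L \<sigma>"
    and M: "locc_measurement n (dA ^ L) (dB ^ L) M"
  shows "\<bar>(\<Sum>i<n. power_prior n \<eta> L i * Re (mat_trace (\<sigma> i * M i))) - 1 / n\<bar>
    \<le> n * max 0 (n * q_G p n dA dB \<eta> \<rho> - 1) ^ L"
proof -
  let ?d = "dA ^ L * dB ^ L" and ?s = "max 0 (n * q_G p n dA dB \<eta> \<rho> - 1)"
  define R where "R = (\<lambda>i. partial_transpose p dA dB (\<rho> i))"
  define N where "N = (\<lambda>i. partial_transpose p (dA ^ L) (dB ^ L) (M i))"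
  define g where "g k = (\<Sum>i<n. cnj (unit_root n (k * i)) *
      tr_prod {..<?d} (fourier_power n dA dB \<eta> R L k) (entries (N i)))" for k
  have sum1: "(\<Sum>i<n. \<eta> i) = 1" and \<eta>: "\<And>i. i < n \<Longrightarrow> 0 \<le> \<eta> i"
    and st: "\<And>i. i < n \<Longrightarrow> state (dA * dB) (\<rho> i)"
    using ens by (auto simp: ensemble_def)
  have n: "0 < n" using sum1 by (cases n) auto
  \<comment> \<open>In dimension 0 no matrix has trace 1.\<close>
  have "0 < dA * dB"
    using st[OF n] by (cases "dA * dB = 0") (auto simp: state_def mat_trace_def dest: psd_carrier)
  then have d: "0 < ?d" by simp
  \<comment> \<open>The LOCC structure of \<open>M\<close> enters here; the estimates below use only
    that the \<open>N i\<close> form a measurement.\<close>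
  have N: "measurement n ?d N"
    unfolding N_def using locc_measurement_pt_measurement[OF M d] .
  have Mc: "M i \<in> carrier_mat ?d ?d" if "i < n" for i
    using M that by (auto simp: locc_measurement_def dest: measurement_carrier)
  have "(\<Sum>i<n. of_real (power_prior n \<eta> L i) * mat_trace (\<sigma> i * M i))
      = (\<Sum>i<n. (1 / of_nat n) * (\<Sum>k<n. cnj (unit_root n (k * i)) *
          tr_prod {..<?d} (fourier_power n dA dB \<eta> R L k) (entries (N i))))"
    unfolding R_def N_def by (intro sum.cong refl power_state_trace_fourier[OF \<eta> \<sigma>] Mc) auto
  also have "\<dots> = (1 / of_nat n) * (\<Sum>k<n. g k)"
    unfolding g_def by (subst sum.swap) (simp add: sum_distrib_left)
  also have "(\<Sum>k<n. g k) = g 0 + (\<Sum>k\<in>{1..<n}. g k)"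
    using n by (simp add: lessThan_atLeast0 sum.atLeast_Suc_lessThan)
  \<comment> \<open>For the trivial character the same operator is paired with every effect; the
    effects sum to the identity, which leaves its trace.\<close>
  also have "g 0 = 1"
  proof -
    have "(\<Sum>r<dA * dB. fourier_op n \<eta> R 0 r r) = (\<Sum>i<n. of_real (\<eta> i) * (\<Sum>r<dA * dB. R i $$ (r, r)))"
      unfolding fourier_op_def by (subst sum.swap) (simp add: sum_distrib_left)
    also have "\<dots> = (\<Sum>i<n. of_real (\<eta> i) * mat_trace (R i))"
      by (simp add: mat_trace_def R_def)
    also have "\<dots> = (\<Sum>i<n. of_real (\<eta> i))"
      using st unfolding R_def
      by (intro sum.cong refl) (simp add: mat_trace_partial_transpose psd_carrier state_def)
    finally have tr1: "(\<Sum>r<dA * dB. fourier_op n \<eta> R 0 r r) = 1"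
      using sum1 by (metis of_real_1 of_real_sum)
    have "g 0 = tr_prod {..<?d} (fourier_power n dA dB \<eta> R L 0) (\<lambda>r s. \<Sum>i<n. N i $$ (r, s))"
      by (simp add: g_def tr_prod_sum_right)
    also have "\<dots> = tr_prod {..<?d} (fourier_power n dA dB \<eta> R L 0) (\<lambda>r s. if r = s then 1 else 0)"
      using measurement_sum_entries[OF N] by (intro tr_prod_cong) auto
    finally show ?thesis using fourier_power_trace[OF tr1] by (simp add: tr_prod_id)
  qed
  finally have eq: "(\<Sum>i<n. of_real (power_prior n \<eta> L i) * mat_trace (\<sigma> i * M i))
      = (1 / of_nat n) * (1 + (\<Sum>k\<in>{1..<n}. g k))" .
  have gb: "cmod (g k) \<le> n * ?s ^ L" if k: "k \<in> {1..<n}" for k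
  proof -
    have tb: "trace_bound {..<?d} (fourier_power n dA dB \<eta> R L k) (?s ^ L)"
      unfolding R_def using k by (intro fourier_power_trace_bound fourier_op_trace_bound ens) auto
    have "cmod (g k) \<le> (\<Sum>i<n. cmod (cnj (unit_root n (k * i)) *
        tr_prod {..<?d} (fourier_power n dA dB \<eta> R L k) (entries (N i))))"
      unfolding g_def by (rule norm_sum)
    also have "\<dots> \<le> (\<Sum>i<n. ?s ^ L * 1)"
    proof (rule sum_mono)
      fix i assume "i \<in> {..<n}"
      then have "op_bound {..<?d} (entries (N i)) 1" using measurement_op_bound[OF N] by simp
      then have "cmod (tr_prod {..<?d} (fourier_power n dA dB \<eta> R L k) (entries (N i))) \<le> ?s ^ L * 1"
        using tb unfolding trace_bound_def by blast
      then show "cmod (cnj (unit_root n (k * i)) *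
          tr_prod {..<?d} (fourier_power n dA dB \<eta> R L k) (entries (N i))) \<le> ?s ^ L * 1"
        by (simp add: norm_mult)
    qed
    finally show ?thesis by simp
  qed
  have "cmod (\<Sum>k\<in>{1..<n}. g k) \<le> (\<Sum>k\<in>{1..<n}. n * ?s ^ L)"
    by (rule order_trans[OF norm_sum sum_mono[OF gb]])
  \<comment> \<open>The nontrivial characters are counted as \<open>n\<close>. With the
    \<open>n\<close> outcomes and the prefactor \<open>1 / n\<close> this leaves the single factor
    \<open>n\<close> of the claim.\<close>
  also have "\<dots> \<le> real n * (n * ?s ^ L)" by (simp add: mult_right_mono)
  finally have b: "cmod (\<Sum>k\<in>{1..<n}. g k) \<le> real n * (n * ?s ^ L)" .
  have "(\<Sum>i<n. power_prior n \<eta> L i * Re (mat_trace (\<sigma> i * M i)))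
      = Re (\<Sum>i<n. of_real (power_prior n \<eta> L i) * mat_trace (\<sigma> i * M i))"
    by simp
  also have "\<dots> = 1 / n + Re (\<Sum>k\<in>{1..<n}. g k) / n"
    unfolding eq by (simp add: add_divide_distrib)
  finally have "\<bar>(\<Sum>i<n. power_prior n \<eta> L i * Re (mat_trace (\<sigma> i * M i))) - 1 / n\<bar>
      = \<bar>Re (\<Sum>k\<in>{1..<n}. g k)\<bar> / n"
    by simp
  also have "\<dots> \<le> (real n * (n * ?s ^ L)) / n"
    by (rule divide_right_mono[OF order_trans[OF abs_Re_le_cmod b]]) simp
  finally show ?thesis using n by simp
qed

theorem corollary1:
  fixes n dA dB :: nat
    and \<eta> :: "nat \<Rightarrow> real"
    and \<rho> :: "nat \<Rightarrow> complex mat"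
    and p :: party
    and \<sigma> :: "nat \<Rightarrow> nat \<Rightarrow> complex mat"
  assumes "ensemble n (dA * dB) \<eta> \<rho>"
    and "q_G p n dA dB \<eta> \<rho> < 2 / real n"
    and "\<And>L. L \<ge> 1 \<Longrightarrow> power_states n dA dB \<eta> \<rho> L (\<sigma> L)"
  shows "(\<lambda>L. p_L n (dA ^ L) (dB ^ L) (power_prior n \<eta> L) (\<sigma> L)) \<longlonglongrightarrow> 1 / real n"
proof -
  let ?s = "max 0 (n * q_G p n dA dB \<eta> \<rho> - 1)"
  have n: "0 < n" using assms(1) by (cases n) (auto simp: ensemble_def)
  have "\<bar>p_L n (dA ^ L) (dB ^ L) (power_prior n \<eta> L) (\<sigma> L) - 1 / n\<bar> \<le> n * ?s ^ L" if "L \<ge> 1" for L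
  proof -
    let ?S = "{\<Sum>i<n. power_prior n \<eta> L i * Re (mat_trace (\<sigma> L i * M i)) | M.
        locc_measurement n (dA ^ L) (dB ^ L) M}"
    have "?S \<noteq> {}" using announce_locc_measurement[OF n] by blast
    moreover have "\<forall>x\<in>?S. \<bar>x - 1 / n\<bar> \<le> n * ?s ^ L"
      using locc_value_bound[OF assms(1) assms(3)[OF \<open>L \<ge> 1\<close>], where p = p] by blast
    \<comment> \<open>The estimate is two-sided and uniform over LOCC measurements, so the supremum
      inherits it without a separate lower bound.\<close>
    ultimately show ?thesis unfolding p_L_def by (rule cSup_asclose)
  qed
  then have ev: "\<forall>\<^sub>F L in sequentially.
      norm (p_L n (dA ^ L) (dB ^ L) (power_prior n \<eta> L) (\<sigma> L) - 1 / n) \<le> norm (n * ?s ^ L) * 1"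
    by (intro eventually_sequentiallyI[of 1]) simp
  have "(\<lambda>L. n * ?s ^ L) \<longlonglongrightarrow> 0"
  proof -
    \<comment> \<open>For positive \<open>n\<close> this is equivalent to the hypothesis
      \<open>q_G < 2 / n\<close>.\<close>
    have "?s < 1" using assms(2) n by (simp add: field_simps)
    then have "(\<lambda>L. ?s ^ L) \<longlonglongrightarrow> 0" by (intro LIMSEQ_power_zero) simp
    then show ?thesis by (rule tendsto_mult_right_zero)
  qed
  from tendsto_0_le[OF this ev] show ?thesis by (rule LIM_zero_cancel)
qed

end
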